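(* The assignment $U\mapsto\mathscr{B}(U)$, sending each open set $U\subseteq\mathbb{R}^N$ to the space $\mathscr{B}(U)$ of Boehmians on $U$, together with the restriction maps $\mathscr{B}(U)\to\mathscr{B}(V)$, $F\mapsto F|_V$, for open $V\subseteq U$, is a sheaf over $\mathbb{R}^N$. That is, it is a presheaf (the restriction map from $\mathscr{B}(V)$ to $\mathscr{B}(V)$ is the identity, and for open $W\subseteq V\subseteq U$ the restriction from $U$ to $V$ followed by the restriction from $V$ to $W$ equals the restriction from $U$ to $W$), and the following two conditions hold for every family $\{U_\alpha\}$ of open sets in $\mathbb{R}^N$ with $U=\bigcup_\alpha U_\alpha$: (a) if $F,G\in\mathscr{B}(U)$ are such that $F|_{U_\alpha}=G|_{U_\alpha}$ for each $\alpha$, then $F=G$; (b) if $F_\alpha\in\mathscr{B}(U_\alpha)$ are Boehmians such that $F_\alpha|_{U_\alpha\cap U_\beta}=F_\beta|_{U_\alpha\cap U_\beta}$ for all $\alpha,\beta$, then there exists $F\in\mathscr{B}(U)$ such that $F|_{U_\alpha}=F_\alpha$ for every $\alpha$.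
   Context: Notation. $K\Subset U$ means that $K$ is a compact subset of the open set $U\subseteq\mathbb{R}^N$. $\mathscr{C}(U)$ is the space of continuous (real-valued) functions on $U$. $B_\varepsilon$ is the ball of radius $\varepsilon$ centered at the origin. $\mathscr{D}_o$ is the set of smooth compactly supported functions $\varphi$ on $\mathbb{R}^N$ with $\varphi\ge 0$ and $\int\varphi=1$; $s(\varphi)=\inf\{\varepsilon>0:\operatorname{supp}\varphi\subset B_\varepsilon\}$. A delta sequence is a sequence $(\varphi_n)$ in $\mathscr{D}_o$ with $s(\varphi_n)\to0$; $\Delta$ is the set of all delta sequences. $f_n\rightrightarrows f$ on $S$ means uniform convergence on $S$. Convolution. $(f*\varphi)(x)=\int f(y)\varphi(x-y)\,dy$, where for $f$ defined only on an open set $U$ the product $f(y)\varphi(x-y)$ is taken to be $0$ whenever $\varphi(x-y)=0$, even if $f$ is not defined at $y$. Convention: if $K\Subset U$ and $(\delta_m)\in\Delta$, then for all but finitely many $m$ the convolutions $f*\delta_m$ with $f\in\mathscr{C}(U)$ are defined on all of $K$; the finitely many indices for which they are not are ignored in statements about convergence on $K$. Boehmians. A sequence $(f_n)$ in $\mathscr{C}(U)$ ($U$ open) is fundamental if for every $K\Subset U$ there is $(\delta_n)\in\Delta$ such that, for every $m\in\mathbb{N}$, the sequence $(f_n*\delta_m)_n$ converges uniformly on $K$ as $n\to\infty$. $\mathscr{A}(U)$ is the set of fundamental sequences on $U$. For $(f_n),(g_n)\in\mathscr{A}(U)$, $(f_n)\sim(g_n)$ means that for every $K\Subset U$ there is $(\varphi_n)\in\Delta$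 such that, for each $m$, $(f_n-g_n)*\varphi_m\rightrightarrows0$ on $K$ as $n\to\infty$. This is an equivalence relation, and $\mathscr{B}(U)=\mathscr{A}(U)/\sim$ is the space of Boehmians on $U$; the class of $(f_n)$ is denoted $[(f_n)]$. For open $V\subseteq U$ and $F=[(f_n)]\in\mathscr{B}(U)$, the restriction is $F|_V=[(f_n|_V)]\in\mathscr{B}(V)$, which is well defined. *)

theory Defs
  imports "HOL-Analysis.Analysis" "HOL-Library.FuncSet"
begin

section \<open>Test functions and delta sequences\<close>

primrec C_k :: "nat \<Rightarrow> ('a::euclidean_space \<Rightarrow> real) \<Rightarrow> bool" where
  "C_k 0 f \<longleftrightarrow> continuous_on UNIV f"
| "C_k (Suc k) f \<longleftrightarrow> f differentiable_on UNIV \<and>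
     (\<forall>i\<in>Basis. C_k k (\<lambda>x. frechet_derivative f (at x) i))"

definition smooth :: "('a::euclidean_space \<Rightarrow> real) \<Rightarrow> bool" where
  "smooth f \<longleftrightarrow> (\<forall>k. C_k k f)"

definition supp :: "('a::euclidean_space \<Rightarrow> real) \<Rightarrow> 'a set" where
  "supp \<phi> = closure (support_on UNIV \<phi>)"

definition D_o :: "('a::euclidean_space \<Rightarrow> real) set" where
  "D_o = {\<phi>. smooth \<phi> \<and> compact (supp \<phi>) \<and> (\<forall>x. 0 \<le> \<phi> x) \<and> integral\<^sup>L lborel \<phi> = 1}"

definition supp_radius :: "('a::euclidean_space \<Rightarrow> real) \<Rightarrow> real" where
  "supp_radius \<phi> = Inf {\<epsilon>. 0 < \<epsilon> \<and> supp \<phi> \<subseteq> ball 0 \<epsilon>}"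

definition delta_seqs :: "(nat \<Rightarrow> 'a::euclidean_space \<Rightarrow> real) set" where
  "delta_seqs = {\<phi>. (\<forall>n. \<phi> n \<in> D_o) \<and> (\<lambda>n. supp_radius (\<phi> n)) \<longlonglongrightarrow> 0}"

section \<open>Continuous functions on an open set and convolution\<close>

text \<open>Functions on \<open>U\<close> are modelled extensionally (value \<open>undefined\<close> off \<open>U\<close>), so that
  they are determined by their values on \<open>U\<close>.\<close>

definition cont_funs :: "'a::euclidean_space set \<Rightarrow> ('a \<Rightarrow> real) set" where
  "cont_funs U = {f \<in> extensional U. continuous_on U f}"

text \<open>The product \<open>f y * \<phi> (x - y)\<close> is \<open>0\<close> whenever \<open>\<phi> (x - y) = 0\<close>, whatever the
  value of \<open>f\<close> at \<open>y\<close>. The value of \<open>conv f \<phi> x\<close> is meaningful for \<open>f \<in> cont_funs U\<close>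
  only where the convolution is defined, which is what \<open>conv_defined U f \<phi> x\<close> expresses.\<close>

definition conv :: "('a::euclidean_space \<Rightarrow> real) \<Rightarrow> ('a \<Rightarrow> real) \<Rightarrow> 'a \<Rightarrow> real" where
  "conv f \<phi> x = (LINT y|lborel. f y * \<phi> (x - y))"

definition conv_defined ::
  "'a::euclidean_space set \<Rightarrow> ('a \<Rightarrow> real) \<Rightarrow> ('a \<Rightarrow> real) \<Rightarrow> 'a \<Rightarrow> bool" where
  "conv_defined U f \<phi> x \<longleftrightarrow>
     (\<forall>y. \<phi> (x - y) \<noteq> 0 \<longrightarrow> y \<in> U) \<and> integrable lborel (\<lambda>y. f y * \<phi> (x - y))"

text \<open>For a delta sequence \<open>\<delta>\<close> and compact \<open>K \<subseteq> U\<close>, all but finitely many \<open>\<delta> m\<close> are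
  admissible for \<open>K\<close>; the remaining indices are ignored in statements about convergence
  on \<open>K\<close>.\<close>

definition admissible :: "'a::euclidean_space set \<Rightarrow> 'a set \<Rightarrow> ('a \<Rightarrow> real) \<Rightarrow> bool" where
  "admissible U K \<phi> \<longleftrightarrow> (\<forall>f\<in>cont_funs U. \<forall>x\<in>K. conv_defined U f \<phi> x)"

section \<open>Boehmians\<close>

definition fundamental_seqs :: "'a::euclidean_space set \<Rightarrow> (nat \<Rightarrow> 'a \<Rightarrow> real) set" where
  "fundamental_seqs U = {f. (\<forall>n. f n \<in> cont_funs U) \<and>
     (\<forall>K. compact K \<and> K \<subseteq> U \<longrightarrow>
        (\<exists>\<delta>\<in>delta_seqs. \<forall>m. admissible U K (\<delta> m) \<longrightarrow>
            uniformly_convergent_on K (\<lambda>n. conv (f n) (\<delta> m))))}"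

definition boehmian_rel ::
  "'a::euclidean_space set \<Rightarrow> ((nat \<Rightarrow> 'a \<Rightarrow> real) \<times> (nat \<Rightarrow> 'a \<Rightarrow> real)) set" where
  "boehmian_rel U = {(f, g). f \<in> fundamental_seqs U \<and> g \<in> fundamental_seqs U \<and>
     (\<forall>K. compact K \<and> K \<subseteq> U \<longrightarrow>
        (\<exists>\<phi>\<in>delta_seqs. \<forall>m. admissible U K (\<phi> m) \<longrightarrow>
            uniform_limit K (\<lambda>n. conv (\<lambda>x\<in>U. f n x - g n x) (\<phi> m)) (\<lambda>_. 0) sequentially))}"

type_synonym 'a boehmian = "(nat \<Rightarrow> 'a \<Rightarrow> real) set"

definition boehmians :: "'a::euclidean_space set \<Rightarrow> 'a boehmian set" where
  "boehmians U = fundamental_seqs U // boehmian_rel U"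

text \<open>The restriction of the class of \<open>f\<close> is the class of \<open>f|\<^sub>V\<close>; the union runs over all
  representatives, whose restrictions all have the same class.\<close>

definition boehmian_restrict :: "'a::euclidean_space set \<Rightarrow> 'a boehmian \<Rightarrow> 'a boehmian" where
  "boehmian_restrict V F = (\<Union>f\<in>F. boehmian_rel V `` {\<lambda>n. restrict (f n) V})"

end

theory Submission
  imports Defs
begin

text \<open>
  Boehmians are determined by what happens near single points, and this turns the sheaf property into a local
  question. The definitions ask, for every compact \<open>K \<subseteq> U\<close>, for a delta sequence along which \<open>f\<^sub>n * \<delta>\<^sub>m\<close>
  converges (or tends to zero) uniformly on \<open>K\<close>. It is equivalent to ask, for every point \<open>x\<close> of \<open>U\<close>, for
  a ball around \<open>x\<close> on which this happens with kernels of arbitrarily small support (\<open>delta_seqs_iff_germ\<close>). The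
  passage from points to compact sets uses that \<open>D_o\<close> is closed under convolution and that a further convolution
  preserves uniform convergence, at the price of a slightly smaller set (\<open>uniform_limit_conv\<close>): finitely many balls
  with individual kernels are all served by the convolution product of these kernels (\<open>common_mollifier\<close>).

  Being fundamental and being equivalent thus become conditions on germs (\<open>fundamental_iff\<close>, \<open>boehmian_rel_iff\<close>).
  The presheaf laws are then clear, and so is the first sheaf condition, since the open sets cover \<open>U\<close>.

  Gluing cannot be done with a partition of unity, because multiplication by a cut-off function does not
  commute with convolution. Regularization takes its place. Given compatible Boehmians on the \<open>U\<^sub>\<alpha>\<close>,
  represented by sequences \<open>f\<^sup>\<alpha>\<close>, and a compact subset of the union, finitely many small balls cover this set and a single
  kernel \<open>\<phi>\<close> makes \<open>f\<^sup>\<alpha>\<^sub>n * \<phi>\<close> converge on each of them for a suitable \<open>\<alpha>\<close>. The limits agree on overlaps: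
  their difference vanishes after convolution with arbitrarily short kernels, and a continuous function is
  recovered from such convolutions (\<open>eq_if_conv_eq\<close>). So they form a continuous function \<open>F * \<phi>\<close> on a neighbourhood of
  the compact set, although \<open>F\<close> itself is not yet available (\<open>glued_regularization\<close>). Along an
  exhaustion of the union by compact sets and kernels \<open>\<phi>\<^sub>j\<close> of shrinking support this yields continuous functions
  \<open>g\<^sub>j = F * \<phi>\<^sub>j\<close>.

  The sequence \<open>g\<close> represents \<open>F\<close>. If \<open>f\<^sup>\<alpha>\<^sub>n * \<delta>\<close> converges to \<open>p\<close> near \<open>x\<close>, then
  \<open>g\<^sub>j * \<delta> = (F * \<phi>\<^sub>j) * \<delta> = (F * \<delta>) * \<phi>\<^sub>j = p * \<phi>\<^sub>j\<close>, which converges to \<open>p\<close> as \<open>j\<close> grows. Hence \<open>g\<close> is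
  fundamental and its restriction to \<open>U\<^sub>\<alpha>\<close> is equivalent to \<open>f\<^sup>\<alpha>\<close> (\<open>conv_exchange\<close>, \<open>regularized_germ\<close>). The
  subtle point is that \<open>g\<^sub>j\<close> is pieced together from limits of \<open>f\<^sup>\<beta>\<close> for various \<open>\<beta>\<close>, while
  \<open>f\<^sup>\<alpha>\<^sub>n * \<phi>\<^sub>j\<close> need not converge; it does so only after yet another convolution, which is removed at the end
  by continuity.
\<close>

section \<open>Convolution\<close>

lemma zero_off_supp: "z \<notin> supp \<phi> \<Longrightarrow> \<phi> z = 0"
  using closure_subset[of "support_on UNIV \<phi>"] by (auto simp: supp_def support_on_def)

lemma supp_subset_closed:
  assumes "closed C" "\<And>z. z \<notin> C \<Longrightarrow> \<phi> z = 0"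
  shows "supp \<phi> \<subseteq> C"
  unfolding supp_def by (rule closure_minimal) (use assms in \<open>auto simp: support_on_def\<close>)

text \<open>The algebra of convolution rests on continuity and compact support alone; smoothness enters with \<open>D_o\<close>.\<close>

definition test_fun :: "('a::euclidean_space \<Rightarrow> real) \<Rightarrow> bool" where
  "test_fun \<phi> \<longleftrightarrow> continuous_on UNIV \<phi> \<and> compact (supp \<phi>)"

lemma test_fun_continuous: "test_fun \<phi> \<Longrightarrow> continuous_on A \<phi>"
  unfolding test_fun_def using continuous_on_subset by blast

lemma test_fun_compact: "test_fun \<phi> \<Longrightarrow> compact (supp \<phi>)"
  by (simp add: test_fun_def)

lemma test_funI:
  assumes "continuous_on UNIV \<phi>" "compact C" "\<And>z. z \<notin> C \<Longrightarrow> \<phi> z = 0"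
  shows "test_fun \<phi>"
proof -
  have "supp \<phi> \<subseteq> C"
    by (rule supp_subset_closed) (use assms compact_imp_closed in auto)
  moreover have "closed (supp \<phi>)"
    by (simp add: supp_def)
  ultimately have "compact (C \<inter> supp \<phi>)" "C \<inter> supp \<phi> = supp \<phi>"
    using \<open>compact C\<close> by (auto intro: compact_Int_closed)
  with assms(1) show ?thesis
    by (simp add: test_fun_def)
qed

lemma integrable_compact_zero_off:
  fixes f :: "'a::euclidean_space \<Rightarrow> real"
  assumes "compact C" "continuous_on C f" "\<And>z. z \<notin> C \<Longrightarrow> f z = 0"
  shows "integrable lborel f"
proof -
  have "integrable lborel (\<lambda>x. indicator C x *\<^sub>R f x)"
    by (rule borel_integrable_compact[OF assms(1,2)])
  moreover have "(\<lambda>x. indicator C x *\<^sub>R f x) = f"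
    using assms(3) by (auto simp: indicator_def fun_eq_iff)
  ultimately show ?thesis by simp
qed

text \<open>The region from which \<open>conv f \<phi> x\<close> takes values of \<open>f\<close>.\<close>

definition minus_supp :: "'a::euclidean_space \<Rightarrow> ('a \<Rightarrow> real) \<Rightarrow> 'a set" where
  "minus_supp x \<phi> = (\<lambda>z. x - z) ` supp \<phi>"

lemma minus_supp_iff: "y \<in> minus_supp x \<phi> \<longleftrightarrow> x - y \<in> supp \<phi>"
  proof
  assume "x - y \<in> supp \<phi>"
  then show "y \<in> minus_supp x \<phi>"
    unfolding minus_supp_def by (intro image_eqI[of _ _ "x - y"]) auto
qed (auto simp: minus_supp_def)

lemma compact_minus_supp: "test_fun \<phi> \<Longrightarrow> compact (minus_supp x \<phi>)"
  unfolding minus_supp_def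
  by (intro compact_continuous_image continuous_intros test_fun_compact)

lemma test_fun_shift_continuous: "test_fun \<phi> \<Longrightarrow> continuous_on A (\<lambda>y. \<phi> (x - y))"
  by (rule continuous_on_compose2[OF test_fun_continuous[of _ UNIV]]) (auto intro: continuous_intros)

lemma integrable_conv:
  assumes "test_fun \<phi>" "continuous_on (minus_supp x \<phi>) f"
  shows "integrable lborel (\<lambda>y. f y * \<phi> (x - y))"
proof (rule integrable_compact_zero_off[OF compact_minus_supp[OF assms(1), of x]])
  show "continuous_on (minus_supp x \<phi>) (\<lambda>y. f y * \<phi> (x - y))"
    by (intro continuous_on_mult assms test_fun_shift_continuous)
qed (simp add: minus_supp_iff zero_off_supp)

lemma conv_cong:
  assumes "\<And>y. y \<in> minus_supp x \<phi> \<Longrightarrow> f y = g y"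
  shows "conv f \<phi> x = conv g \<phi> x"
proof -
  have "f y * \<phi> (x - y) = g y * \<phi> (x - y)" for y
    by (cases "y \<in> minus_supp x \<phi>") (simp_all add: assms minus_supp_iff zero_off_supp)
  then show ?thesis
    unfolding conv_def by (rule arg_cong[where f="integral\<^sup>L lborel", OF ext])
qed

lemma conv_diff:
  assumes "test_fun \<phi>" "continuous_on (minus_supp x \<phi>) f" "continuous_on (minus_supp x \<phi>) g"
  shows "conv (\<lambda>y. f y - g y) \<phi> x = conv f \<phi> x - conv g \<phi> x"
  unfolding conv_def left_diff_distrib
  by (rule Bochner_Integration.integral_diff) (intro integrable_conv assms)+

lemma lborel_reflect: "distr lborel borel (\<lambda>y. x - y) = (lborel :: 'a::euclidean_space measure)"
  using lborel_affine[of "-1" x] by (simp add: density_1)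

lemma lborel_translate: "distr lborel borel (\<lambda>y. y - x) = (lborel :: 'a::euclidean_space measure)"
  using lborel_affine[of 1 "-x"] by (simp add: density_1)

lemma integral_reflect:
  fixes f :: "'a::euclidean_space \<Rightarrow> real"
  assumes "f \<in> borel_measurable borel"
  shows "(LINT y|lborel. f (x - y)) = (LINT y|lborel. f y)"
  by (subst (2) lborel_reflect[of x, symmetric], subst integral_distr) (use assms in auto)

lemma integral_translate:
  fixes f :: "'a::euclidean_space \<Rightarrow> real"
  assumes "f \<in> borel_measurable borel"
  shows "(LINT y|lborel. f (y - x)) = (LINT y|lborel. f y)"
  by (subst (2) lborel_translate[of x, symmetric], subst integral_distr) (use assms in auto)

lemma conv_reflect:
  assumes "test_fun \<phi>" "continuous_on UNIV f"
  shows "conv f \<phi> x = (LINT y|lborel. f (x - y) * \<phi> y)"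
proof -
  have "(\<lambda>y. f y * \<phi> (x - y)) \<in> borel_measurable borel"
    by (intro borel_measurable_continuous_onI continuous_intros test_fun_shift_continuous assms)
  from integral_reflect[OF this, of x] show ?thesis
    by (simp add: conv_def)
qed

lemma conv_commute:
  assumes "test_fun \<phi>" "test_fun \<psi>"
  shows "conv \<phi> \<psi> = conv \<psi> \<phi>"
proof
  fix x
  show "conv \<phi> \<psi> x = conv \<psi> \<phi> x"
    unfolding conv_reflect[OF assms(2) test_fun_continuous[OF assms(1)]]
    by (simp only: conv_def mult.commute)
qed

text \<open>Rewriting the convolution as an integral over one box, the same for all \<open>f\<close> and \<open>x\<close>, gives access to the
  theorems on continuity and differentiability of integrals with a parameter.\<close>

lemma integral_cbox_test_fun:
  fixes \<phi> :: "'a::euclidean_space \<Rightarrow> real"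
  assumes "test_fun \<phi>"
  obtains a b where "\<And>f x. continuous_on UNIV f \<Longrightarrow> conv f \<phi> x = integral (cbox a b) (\<lambda>y. f (x - y) * \<phi> y)"
proof -
  obtain a b where ab: "supp \<phi> \<subseteq> cbox a b"
    using bounded_subset_cbox_symmetric[OF compact_imp_bounded[OF test_fun_compact[OF assms]]] by blast
  show ?thesis
  proof
    fix f :: "'a \<Rightarrow> real" and x assume f: "continuous_on UNIV f"
    have c: "continuous_on A (\<lambda>y. f (x - y) * \<phi> y)" for A
      by (intro continuous_intros test_fun_continuous assms continuous_on_compose2[OF f]) auto
    have i: "integrable lborel (\<lambda>y. f (x - y) * \<phi> y)"
      by (rule integrable_compact_zero_off[OF test_fun_compact[OF assms] c]) (simp add: zero_off_supp)
    have "conv f \<phi> x = integral UNIV (\<lambda>y. f (x - y) * \<phi> y)"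
      unfolding conv_reflect[OF assms f] using integral_lborel[OF i] by simp
    also have "\<dots> = integral (cbox a b) (\<lambda>y. f (x - y) * \<phi> y)"
    proof -
      have "(\<lambda>y. if y \<in> cbox a b then f (x - y) * \<phi> y else 0) = (\<lambda>y. f (x - y) * \<phi> y)"
        using ab zero_off_supp[of _ \<phi>] by (force simp: fun_eq_iff)
      then show ?thesis
        using integral_restrict_UNIV[of "cbox a b" "\<lambda>y. f (x - y) * \<phi> y"] by simp
    qed
    finally show "conv f \<phi> x = integral (cbox a b) (\<lambda>y. f (x - y) * \<phi> y)" .
  qed
qed

lemma continuous_conv:
  assumes "test_fun \<phi>" "continuous_on UNIV f"
  shows "continuous_on A (conv f \<phi>)"
proof -
  obtain a b where ab: "\<And>f x. continuous_on UNIV f \<Longrightarrow> conv f \<phi> x = integral (cbox a b) (\<lambda>y. f (x - y) * \<phi> y)"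
    using integral_cbox_test_fun[OF assms(1)] by blast
  have "continuous_on UNIV (\<lambda>x. integral (cbox a b) (\<lambda>y. f (x - y) * \<phi> y))"
    by (rule integral_continuous_on_param, unfold split_def)
      (intro continuous_intros continuous_on_compose2[OF assms(2)]
       continuous_on_compose2[OF test_fun_continuous[OF assms(1), of UNIV]] subset_UNIV)
  with ab[OF assms(2)] have "continuous_on UNIV (conv f \<phi>)"
    by presburger
  then show ?thesis by (rule continuous_on_subset) simp
qed

text \<open>A non-zero integrand at \<open>y\<close> splits \<open>z = y + (z - y)\<close> into points of the two supports. The set in the
  assumption is the Minkowski sum of the supports.\<close>

lemma conv_zero_off:
  assumes "z \<notin> (\<Union>a\<in>supp \<phi>. \<Union>b\<in>supp \<psi>. {a + b})"
  shows "conv \<phi> \<psi> z = 0"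
proof -
  have "(\<lambda>y. \<phi> y * \<psi> (z - y)) = (\<lambda>_. 0)"
  proof
    fix y
    show "\<phi> y * \<psi> (z - y) = 0"
    proof (rule ccontr)
      assume "\<phi> y * \<psi> (z - y) \<noteq> 0"
      then have "y \<in> supp \<phi>" "z - y \<in> supp \<psi>"
        using zero_off_supp by force+
      moreover have "z = y + (z - y)" by simp
      ultimately show False using assms by (metis UN_I singletonI)
    qed
  qed
  then show ?thesis by (simp only: conv_def lebesgue_integral_const) simp
qed

lemma compact_supp_sum:
  assumes "test_fun \<phi>" "test_fun \<psi>"
  shows "compact (\<Union>a\<in>supp \<phi>. \<Union>b\<in>supp \<psi>. {a + b})"
proof -
  have "(\<Union>a\<in>supp \<phi>. \<Union>b\<in>supp \<psi>. {a + b}) = {a + b |a b. a \<in> supp \<phi> \<and> b \<in> supp \<psi>}"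
    by blast
  then show ?thesis
    using compact_sums[OF assms[THEN test_fun_compact]] by simp
qed

lemma supp_conv:
  assumes "test_fun \<phi>" "test_fun \<psi>"
  shows "supp (conv \<phi> \<psi>) \<subseteq> (\<Union>a\<in>supp \<phi>. \<Union>b\<in>supp \<psi>. {a + b})"
  by (intro supp_subset_closed compact_imp_closed compact_supp_sum assms conv_zero_off)

lemma test_fun_conv:
  assumes "test_fun \<phi>" "test_fun \<psi>"
  shows "test_fun (conv \<phi> \<psi>)"
  by (rule test_funI[OF continuous_conv compact_supp_sum conv_zero_off])
     (use assms test_fun_continuous in auto)

text \<open>A continuous function with compact support on the product space is integrable there, so Fubini applies.\<close>

lemma Fubini_lborel_compact:
  fixes F :: "'a::euclidean_space \<Rightarrow> 'a \<Rightarrow> real"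
  assumes "compact C" "continuous_on UNIV (\<lambda>p. F (fst p) (snd p))"
    "\<And>y z. (y, z) \<notin> C \<Longrightarrow> F y z = 0"
  shows "(LINT y|lborel. LINT z|lborel. F y z) = (LINT z|lborel. LINT y|lborel. F y z)"
proof -
  have "integrable lborel (\<lambda>p. F (fst p) (snd p))"
    using assms by (intro integrable_compact_zero_off[of C]) (auto intro: continuous_on_subset)
  then have "integrable (lborel \<Otimes>\<^sub>M lborel) (case_prod F)"
    by (simp add: lborel_prod split_def)
  from lborel_pair.Fubini_integral[OF this] show ?thesis by simp
qed

text \<open>Fubini exchanges the two integrals; the translation \<open>y \<mapsto> y - z\<close> turns the inner one into
  \<open>conv \<phi> \<psi> (x - z)\<close>.\<close>

lemma conv_assoc_global:
  assumes "test_fun \<phi>" "test_fun \<psi>" "continuous_on UNIV f"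
  shows "conv (conv f \<phi>) \<psi> x = conv f (conv \<phi> \<psi>) x"
proof -
  note c = continuous_on_compose2[OF assms(3)] continuous_on_compose2[OF test_fun_continuous[OF assms(1), of UNIV]]
    continuous_on_compose2[OF test_fun_continuous[OF assms(2), of UNIV]]
  \<comment> \<open>The image of the product of the supports under the inverse of \<open>(y, z) \<mapsto> (x - y, y - z)\<close>; it contains the
    support of the integrand.\<close>
  define C where "C = (\<lambda>(a, b). (x - a, x - a - b)) ` (supp \<psi> \<times> supp \<phi>)"
  have "compact C"
    unfolding C_def split_def
    by (intro compact_continuous_image compact_Times test_fun_compact assms continuous_intros)
  have zero: "f z * \<phi> (y - z) * \<psi> (x - y) = 0" if "(y, z) \<notin> C" for y z
  proof (rule ccontr)
    assume "\<not> ?thesis"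
    then have "y - z \<in> supp \<phi>" "x - y \<in> supp \<psi>"
      using zero_off_supp by force+
    moreover have "(y, z) = (x - (x - y), x - (x - y) - (y - z))" by simp
    ultimately have "(y, z) \<in> C"
      unfolding C_def by (intro image_eqI[of _ _ "(x - y, y - z)"]) auto
    with that show False by simp
  qed
  have "conv (conv f \<phi>) \<psi> x = (LINT y|lborel. LINT z|lborel. f z * \<phi> (y - z) * \<psi> (x - y))"
    by (simp add: conv_def)
  also have "\<dots> = (LINT z|lborel. LINT y|lborel. f z * \<phi> (y - z) * \<psi> (x - y))"
    by (rule Fubini_lborel_compact[OF \<open>compact C\<close> _ zero])
      (intro continuous_intros c subset_UNIV)
  also have "\<dots> = (LINT z|lborel. f z * (LINT y|lborel. \<phi> (y - z) * \<psi> (x - y)))"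
    by (simp add: mult.assoc)
  also have "\<dots> = (LINT z|lborel. f z * conv \<phi> \<psi> (x - z))"
  proof (intro arg_cong[where f="integral\<^sup>L lborel"] ext arg_cong2[where f="(*)"] refl)
    fix z
    have "(\<lambda>w. \<phi> w * \<psi> (x - z - w)) \<in> borel_measurable borel"
      by (intro borel_measurable_continuous_onI continuous_intros c) auto
    from integral_translate[OF this, of z]
    show "(LINT y|lborel. \<phi> (y - z) * \<psi> (x - y)) = conv \<phi> \<psi> (x - z)"
      by (simp add: conv_def)
  qed
  finally show ?thesis
    by (simp add: conv_def)
qed

text \<open>The support condition under which convolving a function on \<open>U\<close> with \<open>\<phi>\<close> is meaningful on \<open>S\<close>. Testing with
  the closed support instead of \<open>{z. \<phi> z \<noteq> 0}\<close> keeps the values that enter at a point of \<open>S\<close> inside a compact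
  subset of \<open>U\<close>, so that integrability is automatic.\<close>

definition fits :: "'a::euclidean_space set \<Rightarrow> 'a set \<Rightarrow> ('a \<Rightarrow> real) \<Rightarrow> bool" where
  "fits U S \<phi> \<longleftrightarrow> (\<forall>x\<in>S. minus_supp x \<phi> \<subseteq> U)"

lemma fitsD: "fits U S \<phi> \<Longrightarrow> x \<in> S \<Longrightarrow> minus_supp x \<phi> \<subseteq> U"
  by (simp add: fits_def)

lemma fits_trans: "fits U S \<phi> \<Longrightarrow> fits S T \<psi> \<Longrightarrow> test_fun \<phi> \<Longrightarrow> test_fun \<psi> \<Longrightarrow> fits U T (conv \<phi> \<psi>)"
  unfolding fits_def minus_supp_def
proof safe
  fix x z assume *: "\<forall>x\<in>S. (-) x ` supp \<phi> \<subseteq> U" "\<forall>x\<in>T. (-) x ` supp \<psi> \<subseteq> S" "test_fun \<phi>" "test_fun \<psi>" "x \<in> T"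
    "z \<in> supp (conv \<phi> \<psi>)"
  then obtain a b where "a \<in> supp \<phi>" "b \<in> supp \<psi>" "z = a + b"
    using supp_conv[of \<phi> \<psi>] by blast
  with * have "x - b - a \<in> U" by blast
  with \<open>z = a + b\<close> show "x - z \<in> U" by (simp add: algebra_simps)
qed

lemma compact_fit:
  assumes "test_fun \<phi>" "compact S" "fits U S \<phi>"
  obtains C where "compact C" "C \<subseteq> U" "fits C S \<phi>"
proof
  let ?C = "{x - y |x y. x \<in> S \<and> y \<in> supp \<phi>}"
  show "compact ?C"
    using assms test_fun_compact by (intro compact_differences) auto
  show "?C \<subseteq> U" "fits ?C S \<phi>"
    using assms(3) by (auto simp: fits_def minus_supp_def)
qed

lemma continuous_extension:
  fixes u :: "'a::euclidean_space \<Rightarrow> real"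
  assumes "compact C" "continuous_on C u"
  obtains v where "continuous_on UNIV v" "\<And>y. y \<in> C \<Longrightarrow> v y = u y"
  by (rule Tietze_unbounded[of C u UNIV]) (use assms in \<open>auto simp: compact_imp_closed\<close>)

text \<open>On \<open>S\<close> the convolution only sees \<open>u\<close> on a compact set, where the Tietze theorem replaces \<open>u\<close> by a globally
  continuous function.\<close>

lemma continuous_conv_local:
  assumes "test_fun \<phi>" "continuous_on U u" "compact S" "fits U S \<phi>"
  shows "continuous_on S (conv u \<phi>)"
proof -
  obtain C where C: "compact C" "C \<subseteq> U" "fits C S \<phi>"
    using compact_fit assms by blast
  obtain v where v: "continuous_on UNIV v" "\<And>y. y \<in> C \<Longrightarrow> v y = u y"
    using continuous_extension[OF C(1) continuous_on_subset[OF assms(2) C(2)]] by blast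
  have "conv u \<phi> x = conv v \<phi> x" if "x \<in> S" for x
    by (rule conv_cong) (use v fitsD[OF C(3) that] in auto)
  then show ?thesis
    using continuous_conv[OF assms(1) v(1), of S] by (simp cong: continuous_on_cong)
qed

text \<open>The same replacement of \<open>u\<close> by a globally continuous function reduces the local law to the global one.\<close>

lemma conv_assoc:
  assumes "test_fun \<phi>" "test_fun \<psi>" "continuous_on U u" "fits U S \<phi>" "fits S T \<psi>" "x \<in> T"
  shows "conv (conv u \<phi>) \<psi> x = conv u (conv \<phi> \<psi>) x"
proof -
  have "fits U (minus_supp x \<psi>) \<phi>"
    using assms(4,5,6) by (auto simp: fits_def)
  then obtain C where C: "compact C" "C \<subseteq> U" "fits C (minus_supp x \<psi>) \<phi>"
    using compact_fit assms compact_minus_supp by metis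
  obtain v where v: "continuous_on UNIV v" "\<And>y. y \<in> C \<Longrightarrow> v y = u y"
    using continuous_extension[OF C(1) continuous_on_subset[OF assms(3) C(2)]] by blast
  have "fits C {x} (conv \<phi> \<psi>)"
    by (rule fits_trans[OF C(3)]) (use assms in \<open>auto simp: fits_def\<close>)
  have "conv (conv u \<phi>) \<psi> x = conv (conv v \<phi>) \<psi> x"
  proof (intro conv_cong)
    fix y z assume "y \<in> minus_supp x \<psi>" "z \<in> minus_supp y \<phi>"
    then show "u z = v z" using C(3) v(2) by (force simp: fits_def)
  qed
  also have "\<dots> = conv v (conv \<phi> \<psi>) x"
    using assms v by (intro conv_assoc_global)
  also have "\<dots> = conv u (conv \<phi> \<psi>) x"
    by (rule conv_cong) (use v \<open>fits C {x} (conv \<phi> \<psi>)\<close> in \<open>auto simp: fits_def\<close>)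
  finally show ?thesis .
qed

section \<open>Mollifiers\<close>

lemma C_k_continuous: "C_k k f \<Longrightarrow> continuous_on A f"
proof -
  assume "C_k k f"
  then have "continuous_on UNIV f"
    by (cases k) (auto intro: differentiable_imp_continuous_on)
  then show ?thesis by (rule continuous_on_subset) simp
qed

text \<open>Differentiation under the integral sign. The parametric theorem wants the derivative as a continuous
  map into bounded linear functions; continuity is checked on the basis, where \<open>C_k\<close> provides it.\<close>

lemma has_derivative_conv:
  fixes \<phi> \<psi> :: "'a::euclidean_space \<Rightarrow> real"
  assumes "C_k (Suc k) \<phi>" "test_fun \<psi>"
  shows "(conv \<phi> \<psi> has_derivative (\<lambda>h. conv (\<lambda>x. frechet_derivative \<phi> (at x) h) \<psi> x)) (at x)"
proof -
  define D where "D = (\<lambda>x. Blinfun (frechet_derivative \<phi> (at x)))"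
  have deriv: "(\<phi> has_derivative frechet_derivative \<phi> (at x)) (at x)" for x
    using assms(1) by (auto simp: differentiable_on_def frechet_derivative_works)
  then have D: "blinfun_apply (D x) = frechet_derivative \<phi> (at x)" for x
    unfolding D_def by (intro bounded_linear_Blinfun_apply has_derivative_bounded_linear[OF deriv])
  have contD: "continuous_on A D" for A
  proof (rule continuous_on_blinfun_componentwise)
    fix i :: 'a assume "i \<in> Basis"
    then show "continuous_on A (\<lambda>x. D x i)"
      using assms(1) C_k_continuous[of k "\<lambda>x. D x i"] by (simp add: D)
  qed
  obtain a b where ab: "\<And>f x. continuous_on UNIV f \<Longrightarrow> conv f \<psi> x = integral (cbox a b) (\<lambda>y. f (x - y) * \<psi> y)"
    using integral_cbox_test_fun[OF assms(2)] by blast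
  define G where "G = (\<lambda>x t. \<psi> t *\<^sub>R D (x - t))"
  note c = continuous_on_compose2[OF contD[of UNIV]] continuous_on_compose2[OF C_k_continuous[OF assms(1), of UNIV]]
    continuous_on_compose2[OF test_fun_continuous[OF assms(2), of UNIV]]
  have "((\<lambda>x. integral (cbox a b) (\<lambda>y. \<phi> (x - y) * \<psi> y)) has_derivative integral (cbox a b) (G x))
      (at x within UNIV)"
  proof (rule leibniz_rule)
    fix x t :: 'a
    have "((\<lambda>x. \<phi> (x - t)) has_derivative frechet_derivative \<phi> (at (x - t))) (at x)"
      by (rule has_derivative_compose[of "\<lambda>x. x - t" "\<lambda>h. h", OF _ deriv])
        (auto intro!: derivative_eq_intros)
    then have "((\<lambda>x. \<phi> (x - t) * \<psi> t) has_derivative (\<lambda>h. frechet_derivative \<phi> (at (x - t)) h * \<psi> t)) (at x)"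
      by (rule has_derivative_mult_left)
    then show "((\<lambda>x. \<phi> (x - t) * \<psi> t) has_derivative blinfun_apply (G x t)) (at x within UNIV)"
      by (simp add: G_def D scaleR_blinfun.rep_eq mult.commute)
  next
    fix x :: 'a
    show "(\<lambda>y. \<phi> (x - y) * \<psi> y) integrable_on cbox a b"
      by (intro integrable_continuous continuous_intros c subset_UNIV)
  next
    show "continuous_on (UNIV \<times> cbox a b) (\<lambda>(x, t). G x t)"
      unfolding G_def split_def by (intro continuous_intros c subset_UNIV)
  qed auto
  moreover have "conv \<phi> \<psi> = (\<lambda>x. integral (cbox a b) (\<lambda>y. \<phi> (x - y) * \<psi> y))"
    using ab[OF C_k_continuous[OF assms(1)]] by blast
  moreover have "blinfun_apply (integral (cbox a b) (G x)) = (\<lambda>h. conv (\<lambda>x. frechet_derivative \<phi> (at x) h) \<psi> x)"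
  proof
    fix h
    have int: "G x integrable_on cbox a b"
      unfolding G_def by (intro integrable_continuous continuous_intros c subset_UNIV)
    have "continuous_on UNIV (\<lambda>x. D x h)"
      by (intro continuous_intros contD)
    then have "continuous_on UNIV (\<lambda>x. frechet_derivative \<phi> (at x) h)"
      by (simp add: D)
    note ab[OF this, of x]
    also have "integral (cbox a b) (\<lambda>y. frechet_derivative \<phi> (at (x - y)) h * \<psi> y)
        = integral (cbox a b) (\<lambda>y. blinfun_apply (G x y) h)"
      by (simp add: G_def D scaleR_blinfun.rep_eq mult.commute)
    also have "\<dots> = integral (cbox a b) (G x) h"
      using int by (rule blinfun_apply_integral[symmetric])
    finally show "integral (cbox a b) (G x) h = conv (\<lambda>x. frechet_derivative \<phi> (at x) h) \<psi> x"
      by simp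
  qed
  ultimately show ?thesis by simp
qed

lemma C_k_conv:
  assumes "C_k k \<phi>" "test_fun \<psi>"
  shows "C_k k (conv \<phi> \<psi>)"
  using assms(1)
proof (induction k arbitrary: \<phi>)
  case 0
  then show ?case using continuous_conv[OF assms(2)] by simp
next
  case (Suc k)
  note d = has_derivative_conv[OF Suc.prems assms(2)]
  have "C_k k (\<lambda>x. frechet_derivative (conv \<phi> \<psi>) (at x) i)" if "i \<in> Basis" for i
  proof -
    have "(\<lambda>x. frechet_derivative (conv \<phi> \<psi>) (at x) i) = conv (\<lambda>x. frechet_derivative \<phi> (at x) i) \<psi>"
      by (rule ext) (simp flip: frechet_derivative_at[OF d])
    with Suc that show ?thesis by simp
  qed
  moreover have "conv \<phi> \<psi> differentiable_on UNIV"
    using d unfolding differentiable_on_def differentiable_def by auto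
  ultimately show ?case by simp
qed

lemma D_o_test_fun: "\<phi> \<in> D_o \<Longrightarrow> test_fun \<phi>"
  unfolding D_o_def test_fun_def smooth_def by (auto dest: spec[where x=0])

lemma D_o_nonneg: "\<phi> \<in> D_o \<Longrightarrow> 0 \<le> \<phi> x"
  by (simp add: D_o_def)

text \<open>Substituting \<open>y \<mapsto> x - y\<close> turns the left side into \<open>c\<close> times the total mass of \<open>\<phi>\<close>.\<close>

lemma conv_const:
  assumes "\<phi> \<in> D_o"
  shows "conv (\<lambda>_. c) \<phi> x = c"
proof -
  have "\<phi> \<in> borel_measurable borel"
    by (intro borel_measurable_continuous_onI test_fun_continuous D_o_test_fun assms)
  then show ?thesis
    using integral_reflect[of \<phi> x] assms by (simp add: conv_def D_o_def)
qed

text \<open>The total mass is read off from convolution with the constant \<open>1\<close>, which every element of \<open>D_o\<close> fixes.\<close>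

lemma D_o_conv:
  assumes "\<phi> \<in> D_o" "\<psi> \<in> D_o"
  shows "conv \<phi> \<psi> \<in> D_o"
proof -
  note t = assms[THEN D_o_test_fun]
  \<comment> \<open>Convolving \<open>1\<close> with \<open>\<phi>\<close> and \<open>\<psi>\<close> in turn returns \<open>1\<close>; by associativity so does \<open>conv \<phi> \<psi>\<close>.\<close>
  have "conv (conv (\<lambda>_. 1) \<phi>) \<psi> 0 = conv (\<lambda>_. 1) (conv \<phi> \<psi>) 0"
    by (intro conv_assoc_global t continuous_intros)
  moreover have "conv (\<lambda>_. 1) \<phi> = (\<lambda>_. 1)"
    using conv_const[OF assms(1)] by blast
  ultimately have "conv (\<lambda>_. 1) (conv \<phi> \<psi>) 0 = 1"
    using conv_const[OF assms(2)] by simp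
  moreover have "conv \<phi> \<psi> \<in> borel_measurable borel"
    by (intro borel_measurable_continuous_onI continuous_conv test_fun_continuous t)
  ultimately have "integral\<^sup>L lborel (conv \<phi> \<psi>) = 1"
    using integral_reflect[of "conv \<phi> \<psi>" 0] by (simp add: conv_def[of "\<lambda>_. 1"])
  moreover have "smooth (conv \<phi> \<psi>)"
    using assms(1) C_k_conv t unfolding D_o_def smooth_def by blast
  moreover have "0 \<le> conv \<phi> \<psi> x" for x
    unfolding conv_def by (intro Bochner_Integration.integral_nonneg mult_nonneg_nonneg D_o_nonneg assms)
  ultimately show ?thesis
    using test_fun_compact[OF test_fun_conv[OF t]] by (simp add: D_o_def)
qed

text \<open>\<open>conv h \<phi> x\<close> is a weighted mean of the values of \<open>h\<close> on \<open>minus_supp x \<phi>\<close>.\<close>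

lemma conv_bound:
  assumes "\<phi> \<in> D_o" "continuous_on (minus_supp x \<phi>) h"
    and "\<And>y. y \<in> minus_supp x \<phi> \<Longrightarrow> \<bar>h y - c\<bar> \<le> e"
  shows "\<bar>conv h \<phi> x - c\<bar> \<le> e"
proof -
  have t: "test_fun \<phi>" by (rule D_o_test_fun) fact
  have i: "integrable lborel (\<lambda>y. a * \<phi> (x - y))" for a
    by (intro integrable_conv t continuous_intros)
  have "conv h \<phi> x \<le> conv (\<lambda>_. c + e) \<phi> x" "conv (\<lambda>_. c - e) \<phi> x \<le> conv h \<phi> x"
    unfolding conv_def
  proof (safe intro!: integral_mono integrable_conv[OF t assms(2)] i)
    fix y
    have "h y \<le> c + e \<and> c - e \<le> h y \<or> \<phi> (x - y) = 0"
    proof (cases "y \<in> minus_supp x \<phi>")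
      case True
      from assms(3)[OF this] show ?thesis by linarith
    qed (simp add: minus_supp_iff zero_off_supp)
    then show "h y * \<phi> (x - y) \<le> (c + e) * \<phi> (x - y)" "(c - e) * \<phi> (x - y) \<le> h y * \<phi> (x - y)"
      using D_o_nonneg[OF assms(1), of "x - y"] by (auto intro: mult_right_mono)
  qed
  then show ?thesis
    by (simp add: conv_const[OF assms(1)] abs_le_iff)
qed

lemma conv_diff_bound:
  assumes "\<phi> \<in> D_o" "continuous_on (minus_supp x \<phi>) h" "continuous_on (minus_supp x \<phi>) g"
    and "\<And>y. y \<in> minus_supp x \<phi> \<Longrightarrow> \<bar>h y - g y\<bar> \<le> e"
  shows "\<bar>conv h \<phi> x - conv g \<phi> x\<bar> \<le> e"
  using conv_bound[OF assms(1), of x "\<lambda>y. h y - g y" 0 e] assms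
  by (simp add: conv_diff D_o_test_fun continuous_on_diff)

text \<open>Mollifiers of range \<open>\<epsilon>\<close>. Existence of a delta sequence with some property of its members amounts to existence
  of mollifiers of every positive range with this property, by \<open>delta_seqs_molls\<close> and \<open>delta_seqsI\<close>.\<close>

definition molls :: "real \<Rightarrow> ('a::euclidean_space \<Rightarrow> real) set" where
  "molls \<epsilon> = {\<phi> \<in> D_o. supp \<phi> \<subseteq> ball 0 \<epsilon>}"

lemma molls_D_o: "\<phi> \<in> molls \<epsilon> \<Longrightarrow> \<phi> \<in> D_o"
  by (simp add: molls_def)

lemma molls_test_fun: "\<phi> \<in> molls \<epsilon> \<Longrightarrow> test_fun \<phi>"
  by (simp add: molls_def D_o_test_fun)

lemma molls_mono: "\<phi> \<in> molls \<epsilon> \<Longrightarrow> \<epsilon> \<le> \<epsilon>' \<Longrightarrow> \<phi> \<in> molls \<epsilon>'"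
  by (auto simp: molls_def)

lemma minus_supp_molls: "\<phi> \<in> molls \<epsilon> \<Longrightarrow> minus_supp x \<phi> \<subseteq> ball x \<epsilon>"
  by (auto simp: molls_def minus_supp_def dist_norm)

lemma fits_molls: "\<phi> \<in> molls \<epsilon> \<Longrightarrow> (\<And>x. x \<in> S \<Longrightarrow> ball x \<epsilon> \<subseteq> U) \<Longrightarrow> fits U S \<phi>"
  unfolding fits_def using minus_supp_molls by blast

lemma fits_cball:
  assumes "\<phi> \<in> molls \<epsilon>" "r + \<epsilon> \<le> s"
  shows "fits (cball x s) (cball x r) \<phi>"
proof (rule fits_molls[OF assms(1)], safe)
  fix y z assume "y \<in> cball x r" "z \<in> ball y \<epsilon>"
  then show "z \<in> cball x s"
    using assms(2) dist_triangle[of x z y] by simp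
qed

lemma fits_subset: "fits U S \<phi> \<Longrightarrow> U \<subseteq> U' \<Longrightarrow> S' \<subseteq> S \<Longrightarrow> fits U' S' \<phi>"
  by (auto simp: fits_def)

lemma molls_conv:
  assumes "\<phi> \<in> molls a" "\<psi> \<in> molls b"
  shows "conv \<phi> \<psi> \<in> molls (a + b)"
proof -
  have "supp (conv \<phi> \<psi>) \<subseteq> ball 0 (a + b)"
  proof
    fix z assume "z \<in> supp (conv \<phi> \<psi>)"
    then obtain p q where "p \<in> supp \<phi>" "q \<in> supp \<psi>" "z = p + q"
      using supp_conv[of \<phi> \<psi>] assms molls_test_fun by blast
    then have "norm p < a" "norm q < b"
      using assms by (auto simp: molls_def)
    then show "z \<in> ball 0 (a + b)"
      using norm_triangle_ineq[of p q] \<open>z = p + q\<close> by simp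
  qed
  then show ?thesis
    using assms D_o_conv by (auto simp: molls_def)
qed

lemma delta_seqs_molls:
  assumes "\<delta> \<in> delta_seqs" "0 < \<epsilon>"
  shows "\<forall>\<^sub>F m in sequentially. \<delta> m \<in> molls \<epsilon>"
proof -
  have "\<forall>\<^sub>F m in sequentially. supp_radius (\<delta> m) < \<epsilon>"
    using assms by (intro order_tendstoD(2)[of _ 0]) (auto simp: delta_seqs_def)
  then show ?thesis
  proof eventually_elim
    case (elim m)
    have D: "\<delta> m \<in> D_o" using assms(1) by (simp add: delta_seqs_def)
    let ?E = "{\<epsilon>. 0 < \<epsilon> \<and> supp (\<delta> m) \<subseteq> ball 0 \<epsilon>}"
    have "bounded (supp (\<delta> m))"
      using D by (simp add: D_o_def compact_imp_bounded)
    then obtain e where "e > 0" "supp (\<delta> m) \<subseteq> ball 0 e"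
      using bounded_subset_ballD by blast
    then have "?E \<noteq> {}" by blast
    then obtain e where "e \<in> ?E" "e < \<epsilon>"
      using elim unfolding supp_radius_def by (subst (asm) cInf_less_iff) (auto intro!: bdd_belowI[of _ 0])
    then show ?case
      using D by (auto simp: molls_def)
  qed
qed

lemma delta_seqsI:
  assumes "\<And>m. \<delta> m \<in> molls (1 / real (Suc m))"
  shows "\<delta> \<in> delta_seqs"
proof -
  have "(\<lambda>m. supp_radius (\<delta> m)) \<longlonglongrightarrow> 0"
  proof (rule real_tendsto_sandwich[OF _ _ tendsto_const LIMSEQ_inverse_real_of_nat])
    have mem: "inverse (real (Suc m)) \<in> {\<epsilon>. 0 < \<epsilon> \<and> supp (\<delta> m) \<subseteq> ball 0 \<epsilon>}" for m
      using assms[of m] by (simp add: molls_def inverse_eq_divide)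
    have "supp_radius (\<delta> m) \<le> inverse (real (Suc m))" for m
      unfolding supp_radius_def by (intro cInf_lower mem bdd_belowI[of _ 0]) simp
    then show "\<forall>\<^sub>F m in sequentially. supp_radius (\<delta> m) \<le> inverse (real (Suc m))"
      by simp
    have "0 \<le> supp_radius (\<delta> m)" for m
      unfolding supp_radius_def using mem[of m] by (intro cInf_greatest) (blast, simp)
    then show "\<forall>\<^sub>F m in sequentially. 0 \<le> supp_radius (\<delta> m)"
      by simp
  qed
  then show ?thesis
    using assms by (auto simp: delta_seqs_def molls_def)
qed

section \<open>A smooth bump function\<close>

text \<open>The functions \<open>exp (-1/t) / t^k\<close> on the positive half-line, extended by zero. They span a space that is
  closed under differentiation, because all of them vanish to infinite order at the origin.\<close>

definition flat :: "nat \<Rightarrow> real \<Rightarrow> real" where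
  "flat k t = (if t > 0 then exp (- inverse t) * inverse t ^ k else 0)"

lemma flat_has_derivative:
  "(flat k has_real_derivative flat (k + 2) t - real k * flat (k + 1) t) (at t)"
proof (cases t "0::real" rule: linorder_cases)
  case less
  have "((\<lambda>_. 0) has_real_derivative 0) (at t)" by simp
  then have "(flat k has_real_derivative 0) (at t)"
    by (rule has_field_derivative_transform_within_open[of _ _ _ "{..<0}"])
      (use less in \<open>auto simp: flat_def\<close>)
  with less show ?thesis by (simp add: flat_def)
next
  case equal
  have "((\<lambda>y. inverse y ^ Suc k / exp (inverse y)) \<longlongrightarrow> 0) (at_right (0::real))"
    by (rule filterlim_compose[OF tendsto_power_div_exp_0 filterlim_inverse_at_top_right])
  then have "((\<lambda>y. flat k y / y) \<longlongrightarrow> 0) (at_right 0)"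
    by (rule Lim_transform_eventually)
      (auto simp: eventually_at_right_field flat_def exp_minus divide_simps intro!: exI[of _ 1])
  moreover have "((\<lambda>y. flat k y / y) \<longlongrightarrow> 0) (at_left 0)"
    by (rule tendsto_eventually) (auto simp: eventually_at_left_field flat_def intro!: exI[of _ "-1"])
  ultimately have "((\<lambda>y. flat k y / y) \<longlongrightarrow> 0) (at 0)"
    by (simp add: filterlim_split_at)
  with equal show ?thesis
    by (simp add: has_field_derivative_iff flat_def)
next
  case greater
  have "((\<lambda>t. exp (- inverse t) * inverse t ^ k) has_real_derivative
      exp (- inverse t) * inverse t ^ (k + 2) - real k * (exp (- inverse t) * inverse t ^ (k + 1))) (at t)"
  proof -
    have p: "((\<lambda>t. inverse t ^ k) has_real_derivative - (real k * inverse t ^ (k + 1))) (at t)"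
      by (rule DERIV_power[OF DERIV_inverse, THEN DERIV_cong]) (use greater in \<open>cases k; simp\<close>)+
    have e: "((\<lambda>t. exp (- inverse t)) has_real_derivative exp (- inverse t) * inverse t ^ 2) (at t)"
      using greater by (auto intro!: derivative_eq_intros simp: power2_eq_square)
    show ?thesis
      by (rule DERIV_cong[OF DERIV_mult[OF e p]]) (simp add: power_add power2_eq_square algebra_simps)
  qed
  then have "(flat k has_real_derivative
      exp (- inverse t) * inverse t ^ (k + 2) - real k * (exp (- inverse t) * inverse t ^ (k + 1))) (at t)"
    by (rule has_field_derivative_transform_within_open[of _ _ _ "{0<..}"])
      (use greater in \<open>auto simp: flat_def\<close>)
  with greater show ?thesis by (simp add: flat_def)
qed

text \<open>An algebra of functions that contains a bump function and is closed under partial derivatives; all its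
  members are therefore smooth. This avoids computing higher derivatives of the bump.\<close>

inductive_set bump_alg :: "real \<Rightarrow> ('a::euclidean_space \<Rightarrow> real) set" for r where
  const: "(\<lambda>_. c) \<in> bump_alg r"
| inner: "(\<lambda>x. x \<bullet> b) \<in> bump_alg r"
| flat: "(\<lambda>x. flat k (r\<^sup>2 - x \<bullet> x)) \<in> bump_alg r"
| add: "f \<in> bump_alg r \<Longrightarrow> g \<in> bump_alg r \<Longrightarrow> (\<lambda>x. f x + g x) \<in> bump_alg r"
| mult: "f \<in> bump_alg r \<Longrightarrow> g \<in> bump_alg r \<Longrightarrow> (\<lambda>x. f x * g x) \<in> bump_alg r"

text \<open>Only the generator \<open>flat\<close> is of interest: the chain rule leads to \<open>flat (k + 2)\<close>, \<open>flat (k + 1)\<close> and a linear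
  factor, all of which lie in the algebra.\<close>

lemma bump_alg_derivative:
  assumes "f \<in> bump_alg r"
  shows "\<exists>f'. (\<forall>x. (f has_derivative f' x) (at x)) \<and> (\<forall>i\<in>Basis. (\<lambda>x. f' x i) \<in> bump_alg r)"
  using assms
proof induction
  case (const c)
  show ?case
    by (rule exI[of _ "\<lambda>_ _. 0"]) (auto intro: bump_alg.const)
next
  case (inner b)
  show ?case
    by (rule exI[of _ "\<lambda>_ h. h \<bullet> b"]) (auto intro!: bump_alg.const derivative_eq_intros)
next
  case (flat k)
  let ?d = "\<lambda>x. flat (k + 2) (r\<^sup>2 - x \<bullet> x) + (- real k) * flat (k + 1) (r\<^sup>2 - x \<bullet> x)"
  have "((\<lambda>x. flat k (r\<^sup>2 - x \<bullet> x)) has_derivative (\<lambda>h. ?d x * (- 2 * (x \<bullet> h)))) (at x)" for x :: 'a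
  proof -
    have "((\<lambda>x. r\<^sup>2 - x \<bullet> x) has_derivative (\<lambda>h. - 2 * (x \<bullet> h))) (at x)"
      by (auto intro!: derivative_eq_intros simp: inner_commute)
    from has_derivative_compose[OF this flat_has_derivative[unfolded has_field_derivative_def]]
    show ?thesis by (simp add: mult.commute)
  qed
  moreover have "(\<lambda>x. ?d x * (- 2 * (x \<bullet> i))) \<in> bump_alg r" for i
    by (intro bump_alg.intros)
  ultimately show ?case by (intro exI[of _ "\<lambda>x h. ?d x * (- 2 * (x \<bullet> h))"]) auto
next
  case (add f g)
  then obtain f' g' where d: "\<And>x. (f has_derivative f' x) (at x)" "\<And>x. (g has_derivative g' x) (at x)"
    "\<And>i. i \<in> Basis \<Longrightarrow> (\<lambda>x. f' x i) \<in> bump_alg r" "\<And>i. i \<in> Basis \<Longrightarrow> (\<lambda>x. g' x i) \<in> bump_alg r"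
    by blast
  show ?case
    by (rule exI[of _ "\<lambda>x h. f' x h + g' x h"]) (auto intro!: bump_alg.add d derivative_intros)
next
  case (mult f g)
  then obtain f' g' where d: "\<And>x. (f has_derivative f' x) (at x)" "\<And>x. (g has_derivative g' x) (at x)"
    "\<And>i. i \<in> Basis \<Longrightarrow> (\<lambda>x. f' x i) \<in> bump_alg r" "\<And>i. i \<in> Basis \<Longrightarrow> (\<lambda>x. g' x i) \<in> bump_alg r"
    by blast
  show ?case
    by (rule exI[of _ "\<lambda>x h. f x * g' x h + f' x h * g x"])
      (auto intro!: bump_alg.add bump_alg.mult d mult.hyps derivative_intros)
qed

lemma bump_alg_smooth:
  assumes "f \<in> bump_alg r"
  shows "smooth f"
proof -
  have "C_k k f" for k
    using assms
  proof (induction k arbitrary: f)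
    case 0
    then show ?case
      using bump_alg_derivative[OF 0] by (auto simp: continuous_on_eq_continuous_at intro: has_derivative_continuous)
  next
    case (Suc k)
    from bump_alg_derivative[OF Suc.prems] obtain f' where
      f': "\<And>x. (f has_derivative f' x) (at x)" "\<And>i. i \<in> Basis \<Longrightarrow> (\<lambda>x. f' x i) \<in> bump_alg r"
      by blast
    have "(\<lambda>x. frechet_derivative f (at x) i) = (\<lambda>x. f' x i)" for i
      by (rule ext) (simp flip: frechet_derivative_at[OF f'(1)])
    then show ?case
      using f' Suc.IH by (auto simp: differentiable_on_def differentiable_def)
  qed
  then show ?thesis by (simp add: smooth_def)
qed

text \<open>Without such functions there would be no delta sequences at all, and not even the zero sequence would
  define a Boehmian.\<close>

lemma molls_nonempty:
  assumes "0 < \<epsilon>"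
  obtains \<phi> :: "'a::euclidean_space \<Rightarrow> real" where "\<phi> \<in> molls \<epsilon>"
proof -
  define r where "r = \<epsilon> / 2"
  have r: "0 < r" "r < \<epsilon>" using assms by (auto simp: r_def)
  define \<eta> :: "'a \<Rightarrow> real" where "\<eta> = (\<lambda>x. flat 0 (r\<^sup>2 - x \<bullet> x))"
  have nn: "0 \<le> \<eta> x" for x by (simp add: \<eta>_def flat_def)
  have zero_iff: "\<eta> x = 0 \<longleftrightarrow> r \<le> norm x" for x
  proof -
    have "(norm x)\<^sup>2 < r\<^sup>2 \<longleftrightarrow> norm x < r"
      using r by (metis norm_ge_zero less_imp_le power2_less_imp_less power_strict_mono zero_less_numeral)
    then show ?thesis by (auto simp: \<eta>_def flat_def dot_square_norm)
  qed
  have alg: "\<eta> \<in> bump_alg r" unfolding \<eta>_def by (rule bump_alg.flat)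
  have s: "supp \<eta> \<subseteq> cball 0 r"
    by (rule supp_subset_closed) (auto simp: zero_iff)
  have "continuous_on UNIV \<eta>"
    using bump_alg_smooth[OF alg] by (auto simp: smooth_def intro: C_k_continuous)
  then have t: "test_fun \<eta>"
    by (rule test_funI[of _ "cball 0 r"]) (auto simp: zero_iff)
  define I where "I = integral\<^sup>L lborel \<eta>"
  have int: "integrable lborel \<eta>"
    by (rule integrable_compact_zero_off[of "supp \<eta>"])
      (simp_all add: t test_fun_compact test_fun_continuous zero_off_supp)
  have "I \<noteq> 0"
  proof
    assume "I = 0"
    then have "AE x in lborel. \<eta> x = 0"
      using integral_nonneg_eq_0_iff_AE[OF int] nn by (simp add: I_def)
    moreover have "{x. \<eta> x \<noteq> 0} = ball (0 :: 'a) r"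
      by (auto simp: zero_iff)
    ultimately have "ball (0 :: 'a) r \<in> null_sets lborel"
      by (subst AE_iff_null_sets) (simp_all add: zero_iff not_less)
    then have "negligible (ball 0 r :: 'a set)"
      by (simp add: negligible_iff_null_sets null_sets_completionI)
    then show False
      using r open_not_negligible[of "ball 0 r :: 'a set"] by simp
  qed
  moreover have "0 \<le> I" unfolding I_def by (intro Bochner_Integration.integral_nonneg nn)
  ultimately have "0 < I" by simp
  define \<phi> where "\<phi> = (\<lambda>x. inverse I * \<eta> x)"
  have "\<phi> \<in> bump_alg r"
    unfolding \<phi>_def by (intro bump_alg.mult bump_alg.const alg)
  then have "smooth \<phi>" by (rule bump_alg_smooth)
  moreover have sp: "supp \<phi> = supp \<eta>"
    using \<open>0 < I\<close> by (simp add: supp_def support_on_def \<phi>_def)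
  moreover have "integral\<^sup>L lborel \<phi> = 1"
    using \<open>0 < I\<close> unfolding \<phi>_def by (simp add: I_def)
  ultimately have "\<phi> \<in> molls \<epsilon>"
    using s r \<open>0 < I\<close> nn test_fun_compact[OF t] by (auto simp: molls_def D_o_def \<phi>_def)
  then show ?thesis by (rule that)
qed

section \<open>Germs\<close>

lemma eventually_molls_fit:
  assumes "open V" "compact K" "K \<subseteq> V"
  shows "\<forall>\<^sub>F d in at_right 0. \<forall>\<phi>\<in>molls d. fits V K \<phi>"
proof -
  obtain e where e: "e > 0" "(\<Union>x\<in>K. ball x e) \<subseteq> V"
    by (rule compact_subset_open_imp_ball_epsilon_subset[OF assms(2,1,3)])
  have "\<forall>\<phi>\<in>molls d. fits V K \<phi>" if "d < e" for d
  proof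
    fix \<phi> :: "'a \<Rightarrow> real" assume "\<phi> \<in> molls d"
    then show "fits V K \<phi>"
    proof (rule fits_molls)
      fix x assume "x \<in> K"
      then show "ball x d \<subseteq> V"
        using e(2) subset_ball[of d e x] that by auto
    qed
  qed
  then show ?thesis
    using e(1) eventually_at_right_field by blast
qed

definition antitone :: "('a set \<Rightarrow> 'b \<Rightarrow> bool) \<Rightarrow> bool" where
  "antitone Q \<longleftrightarrow> (\<forall>S T \<phi>. Q S \<phi> \<longrightarrow> T \<subseteq> S \<longrightarrow> Q T \<phi>)"

text \<open>Uniform convergence of \<open>u\<^sub>n * \<phi>\<close> on \<open>S\<close> and its uniform convergence to zero are treated together, as relations
  \<open>Q S \<phi>\<close>. These are the properties of such relations on which the passage between points and compact sets rests. The
  last one says that a further convolution costs a shrinking of \<open>S\<close> but does no harm otherwise.\<close>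

definition local_property :: "'a::euclidean_space set \<Rightarrow> ('a set \<Rightarrow> ('a \<Rightarrow> real) \<Rightarrow> bool) \<Rightarrow> bool" where
  "local_property U Q \<longleftrightarrow> antitone Q \<and> (\<forall>\<phi>. Q {} \<phi>) \<and> (\<forall>S T \<phi>. Q S \<phi> \<longrightarrow> Q T \<phi> \<longrightarrow> Q (S \<union> T) \<phi>) \<and>
     (\<forall>S T \<phi> \<psi>. compact S \<and> \<phi> \<in> D_o \<and> \<psi> \<in> D_o \<and> fits U S \<phi> \<and> fits S T \<psi> \<and> Q S \<phi> \<longrightarrow> Q T (conv \<phi> \<psi>))"

lemma antitoneD: "antitone Q \<Longrightarrow> Q S \<phi> \<Longrightarrow> T \<subseteq> S \<Longrightarrow> Q T \<phi>"
  by (simp add: antitone_def)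

lemma local_property_antitone: "local_property U Q \<Longrightarrow> antitone Q"
  by (simp add: local_property_def)

lemma local_property_conv:
  assumes "local_property U Q" "compact S" "\<phi> \<in> D_o" "\<psi> \<in> D_o" "fits U S \<phi>" "fits S T \<psi>" "Q S \<phi>"
  shows "Q T (conv \<phi> \<psi>)"
  using assms(1)[unfolded local_property_def, THEN conjunct2, THEN conjunct2, THEN conjunct2,
      rule_format, of S \<phi> \<psi> T] assms(2-7) by simp

lemma local_property_Union:
  assumes "local_property U Q" "finite A" "\<And>i. i \<in> A \<Longrightarrow> Q (S i) \<phi>"
  shows "Q (\<Union>i\<in>A. S i) \<phi>"
  using assms(2,3)
proof (induction A)
  case empty
  then show ?case using assms(1) by (simp add: local_property_def)
next
  case (insert i A)
  then have "Q (S i) \<phi>" "Q (\<Union>i\<in>A. S i) \<phi>" by auto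
  then have "Q (S i \<union> (\<Union>i\<in>A. S i)) \<phi>"
    using assms(1)[unfolded local_property_def, THEN conjunct2, THEN conjunct2, THEN conjunct1] by simp
  then show ?case by simp
qed

text \<open>The pointwise counterpart of the conditions that define Boehmians: near \<open>x\<close> the relation \<open>Q\<close> holds for
  mollifiers of arbitrarily small range. The ball must not depend on the range.\<close>

definition germ :: "('a::euclidean_space set \<Rightarrow> ('a \<Rightarrow> real) \<Rightarrow> bool) \<Rightarrow> 'a \<Rightarrow> bool" where
  "germ Q x \<longleftrightarrow> (\<exists>r>0. \<forall>\<epsilon>>0. \<exists>\<phi>\<in>molls \<epsilon>. Q (cball x r) \<phi>)"

lemma germ_radius:
  assumes "germ Q x" "antitone Q" "0 < R"
  obtains r where "0 < r" "r \<le> R" "\<forall>\<epsilon>>0. \<exists>\<phi>\<in>molls \<epsilon>. Q (cball x r) \<phi>"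
proof -
  obtain r where r: "r > 0" "\<And>\<epsilon>. 0 < \<epsilon> \<Longrightarrow> \<exists>\<phi>\<in>molls \<epsilon>. Q (cball x r) \<phi>"
    using assms(1) unfolding germ_def by blast
  have "\<exists>\<phi>\<in>molls \<epsilon>. Q (cball x (min r R)) \<phi>" if e: "0 < \<epsilon>" for \<epsilon>
  proof -
    obtain \<phi> where "\<phi> \<in> molls \<epsilon>" "Q (cball x r) \<phi>"
      using r(2)[OF e] by blast
    then show ?thesis
      using antitoneD[OF assms(2), of "cball x r" \<phi> "cball x (min r R)"] by (auto simp: subset_cball)
  qed
  then show ?thesis
    using that[of "min r R"] r(1) assms(3) by auto
qed

text \<open>Germs do not see what happens away from \<open>x\<close>: a ball around \<open>x\<close> and mollifiers that are small compared with
  \<open>V\<close> suffice to test them.\<close>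

lemma germ_mono:
  assumes "germ Q x" "antitone Q" "open V" "x \<in> V"
    and "\<And>S \<phi>. \<phi> \<in> D_o \<Longrightarrow> fits V S \<phi> \<Longrightarrow> Q S \<phi> \<Longrightarrow> Q' S \<phi>"
  shows "germ Q' x"
proof -
  obtain R where R: "R > 0" "cball x R \<subseteq> V"
    using assms(3,4) open_contains_cball by blast
  obtain r where r: "0 < r" "r \<le> R/2" "\<forall>\<epsilon>>0. \<exists>\<phi>\<in>molls \<epsilon>. Q (cball x r) \<phi>"
    using germ_radius[OF assms(1,2), of "R/2"] R by auto
  have "\<exists>\<phi>\<in>molls \<epsilon>. Q' (cball x r) \<phi>" if e: "0 < \<epsilon>" for \<epsilon>
  proof -
    obtain \<phi> where \<phi>: "\<phi> \<in> molls (min \<epsilon> (R/2))" "Q (cball x r) \<phi>"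
    proof -
      have "0 < min \<epsilon> (R/2)" using e R(1) by simp
      with r(3) show thesis using that by blast
    qed
    have "fits (cball x R) (cball x r) \<phi>"
      by (rule fits_cball[OF \<phi>(1)]) (use r in auto)
    then have "fits V (cball x r) \<phi>"
      by (rule fits_subset[OF _ R(2) order_refl])
    then have "Q' (cball x r) \<phi>"
      by (rule assms(5)[OF molls_D_o[OF \<phi>(1)] _ \<phi>(2)])
    then show ?thesis
      using molls_mono[OF \<phi>(1) min.cobounded1] by blast
  qed
  with r(1) show ?thesis unfolding germ_def by blast
qed

text \<open>Mollifiers for the single balls are multiplied together: if \<open>\<phi>\<close> serves the balls of \<open>A\<close> and \<open>\<psi>\<close> serves the
  ball of \<open>j\<close>, then \<open>conv \<phi> \<psi>\<close> serves all of them, on balls that are smaller by the ranges of \<open>\<phi>\<close> and \<open>\<psi>\<close>. The radii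
  may be any numbers below the given ones, which leaves room for the induction.\<close>

lemma common_mollifier:
  fixes Q :: "'i \<Rightarrow> 'a::euclidean_space set \<Rightarrow> ('a \<Rightarrow> real) \<Rightarrow> bool"
  assumes "finite A"
    and "\<And>i. i \<in> A \<Longrightarrow> local_property (V i) (Q i)"
    and "\<And>i. i \<in> A \<Longrightarrow> open (V i)" "\<And>i. i \<in> A \<Longrightarrow> cball (x i) (R i) \<subseteq> V i"
    and "\<And>i \<epsilon>. i \<in> A \<Longrightarrow> 0 < \<epsilon> \<Longrightarrow> \<exists>\<phi>\<in>molls \<epsilon>. Q i (cball (x i) (R i)) \<phi>"
    and "\<And>i. i \<in> A \<Longrightarrow> r i < R i" "0 < \<epsilon>"
  shows "\<exists>\<phi>\<in>molls \<epsilon>. \<forall>i\<in>A. Q i (cball (x i) (r i)) \<phi>"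
  using assms
proof (induction A arbitrary: r \<epsilon>)
  case empty
  then show ?case using molls_nonempty by (metis empty_iff)
next
  case (insert j A)
  \<comment> \<open>Intermediate radii: the induction hypothesis reaches \<open>s i\<close>, and the step to \<open>r i\<close> absorbs the range of \<open>\<psi>\<close>.\<close>
  define s where "s = (\<lambda>i. (r i + R i) / 2)"
  have s: "r i < s i" "s i < R i" if "i \<in> insert j A" for i
    using insert.prems(5)[OF that] by (auto simp: s_def)
  have "\<forall>\<^sub>F d in at_right 0. (\<forall>\<phi>\<in>molls d. fits (V i) (cball (x i) (R i)) \<phi>) \<and> d < s i - r i \<and> d < R i - s i"
    if "i \<in> insert j A" for i
    using s[OF that]
    by (intro eventually_conj eventually_molls_fit insert.prems compact_cball that eventually_at_right_less
        order_tendstoD(2)[OF tendsto_ident_at]) auto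
  then have "\<forall>\<^sub>F d in at_right 0. \<forall>i\<in>insert j A.
      (\<forall>\<phi>\<in>molls d. fits (V i) (cball (x i) (R i)) \<phi>) \<and> d < s i - r i \<and> d < R i - s i"
    by (intro eventually_ball_finite) (use insert.hyps in auto)
  moreover have "\<forall>\<^sub>F d in at_right 0. 0 < d \<and> d < \<epsilon> / 2"
    using insert.prems(6) by (auto simp: eventually_at_right_field intro!: exI[of _ "\<epsilon> / 2"])
  ultimately have "\<forall>\<^sub>F d in at_right 0. (\<forall>i\<in>insert j A.
      (\<forall>\<phi>\<in>molls d. fits (V i) (cball (x i) (R i)) \<phi>) \<and> d < s i - r i \<and> d < R i - s i) \<and> 0 < d \<and> d < \<epsilon> / 2"
    by (rule eventually_conj)
  from eventually_happens'[OF _ this] obtain d where d: "0 < d" "d < \<epsilon> / 2" "\<And>i. i \<in> insert j A \<Longrightarrow> d < s i - r i"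
      "\<And>i. i \<in> insert j A \<Longrightarrow> d < R i - s i"
      "\<And>i \<phi>. i \<in> insert j A \<Longrightarrow> \<phi> \<in> molls d \<Longrightarrow> fits (V i) (cball (x i) (R i)) \<phi>"
    by (auto simp: trivial_limit_at_right_real)
  obtain \<phi> where \<phi>: "\<phi> \<in> molls d" "\<And>i. i \<in> A \<Longrightarrow> Q i (cball (x i) (s i)) \<phi>"
  proof -
    have "\<exists>\<phi>\<in>molls d. \<forall>i\<in>A. Q i (cball (x i) (s i)) \<phi>"
      by (rule insert.IH) (use insert.prems(1-4) s d(1) in auto)
    then show thesis using that by blast
  qed
  obtain \<psi> where \<psi>: "\<psi> \<in> molls d" "Q j (cball (x j) (R j)) \<psi>"
    using insert.prems(4) d(1) by blast
  have "conv \<phi> \<psi> \<in> molls \<epsilon>"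
    using molls_mono[OF molls_conv[OF \<phi>(1) \<psi>(1)], of \<epsilon>] d(2) by simp
  moreover have "Q i (cball (x i) (r i)) (conv \<phi> \<psi>)" if "i \<in> A" for i
  proof (rule local_property_conv)
    show "local_property (V i) (Q i)" "compact (cball (x i) (s i))" "\<phi> \<in> D_o" "\<psi> \<in> D_o"
      "Q i (cball (x i) (s i)) \<phi>"
      using insert.prems(1) that \<phi> \<psi> molls_D_o by auto
    show "fits (V i) (cball (x i) (s i)) \<phi>"
      using fits_subset[OF d(5)[OF _ \<phi>(1), of i], of "V i" "cball (x i) (s i)"] that s[of i] by (simp add: subset_cball)
    show "fits (cball (x i) (s i)) (cball (x i) (r i)) \<psi>"
      using d(3)[of i] that by (intro fits_cball[OF \<psi>(1)]) auto
  qed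
  moreover have "Q j (cball (x j) (r j)) (conv \<psi> \<phi>)"
  proof (rule local_property_conv)
    show "local_property (V j) (Q j)" "compact (cball (x j) (R j))" "\<phi> \<in> D_o" "\<psi> \<in> D_o"
      "Q j (cball (x j) (R j)) \<psi>"
      using insert.prems(1) \<phi> \<psi> molls_D_o by auto
    show "fits (V j) (cball (x j) (R j)) \<psi>"
      using d(5) \<psi>(1) by auto
    show "fits (cball (x j) (R j)) (cball (x j) (r j)) \<phi>"
      using d(4)[of j] s[of j] by (intro fits_cball[OF \<phi>(1)]) auto
  qed
  then have "Q j (cball (x j) (r j)) (conv \<phi> \<psi>)"
    using conv_commute \<phi> \<psi> molls_test_fun by metis
  ultimately show ?case by blast
qed

lemma germ_conj:
  assumes "open U" "x \<in> U" "local_property U P" "local_property U Q" "germ P x" "germ Q x"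
  shows "germ (\<lambda>S \<phi>. P S \<phi> \<and> Q S \<phi>) x"
proof -
  obtain R where R: "R > 0" "cball x R \<subseteq> U"
    using assms(1,2) open_contains_cball by blast
  obtain r where r: "0 < r" "r \<le> R" "\<forall>\<epsilon>>0. \<exists>\<phi>\<in>molls \<epsilon>. P (cball x r) \<phi>"
    using germ_radius[OF assms(5) local_property_antitone[OF assms(3)] R(1)] by blast
  obtain s where s: "0 < s" "s \<le> R" "\<forall>\<epsilon>>0. \<exists>\<phi>\<in>molls \<epsilon>. Q (cball x s) \<phi>"
    using germ_radius[OF assms(6) local_property_antitone[OF assms(4)] R(1)] by blast
  define t where "t = min r s / 2"
  have t: "0 < t" "t < r" "t < s" using r s by (auto simp: t_def)
  have sub: "cball x r \<subseteq> U" "cball x s \<subseteq> U"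
    using R(2) subset_cball[OF r(2), of x] subset_cball[OF s(2), of x] by auto
  have "\<exists>\<phi>\<in>molls \<epsilon>. \<forall>i\<in>UNIV. (if i then P else Q) (cball x t) \<phi>" if "0 < \<epsilon>" for \<epsilon>
  proof (rule common_mollifier[where V = "\<lambda>_. U" and R = "\<lambda>i. if i then r else s" and
        x = "\<lambda>_. x" and r = "\<lambda>_. t" and Q = "\<lambda>i. if i then P else Q"])
    show "\<exists>\<phi>\<in>molls \<epsilon>. (if i then P else Q) (cball x (if i then r else s)) \<phi>" if "0 < \<epsilon>" for i \<epsilon>
      using r(3) s(3) that by (cases i) simp_all
    show "local_property U (if i then P else Q)" for i
      using assms(3,4) by (cases i) simp_all
    show "cball x (if i then r else s) \<subseteq> U" for i
      using sub by (cases i) simp_all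
    show "t < (if i then r else s)" for i
      using t by (cases i) simp_all
  qed (use assms(1) that in simp_all)
  then have "\<exists>\<phi>\<in>molls \<epsilon>. P (cball x t) \<phi> \<and> Q (cball x t) \<phi>" if "0 < \<epsilon>" for \<epsilon>
    using that by (auto simp: UNIV_bool)
  with t(1) show ?thesis unfolding germ_def by blast
qed

text \<open>A compact set is covered by finitely many balls of half the radius at which the germs live, and these
  balls share a mollifier.\<close>

lemma germs_imp_compact:
  assumes "open U" "local_property U Q" "\<And>x. x \<in> U \<Longrightarrow> germ Q x" "compact K" "K \<subseteq> U" "0 < \<epsilon>"
  shows "\<exists>\<phi>\<in>molls \<epsilon>. Q K \<phi>"
proof -
  have "\<exists>r>0. cball x r \<subseteq> U \<and> (\<forall>\<epsilon>>0. \<exists>\<phi>\<in>molls \<epsilon>. Q (cball x r) \<phi>)" if xK: "x \<in> K" for x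
  proof -
    obtain R where R: "R > 0" "cball x R \<subseteq> U"
      using assms(1)[unfolded open_contains_cball, rule_format, OF subsetD[OF assms(5) xK]] by blast
    obtain r where "0 < r" "r \<le> R" "\<forall>\<epsilon>>0. \<exists>\<phi>\<in>molls \<epsilon>. Q (cball x r) \<phi>"
      using germ_radius[OF assms(3)[OF subsetD[OF assms(5) xK]] local_property_antitone[OF assms(2)] R(1)] by blast
    moreover have "cball x r \<subseteq> U"
      using R(2) subset_cball[OF \<open>r \<le> R\<close>, of x] by auto
    ultimately show ?thesis by blast
  qed
  then have "\<forall>x\<in>K. \<exists>r. r > 0 \<and> cball x r \<subseteq> U \<and> (\<forall>\<epsilon>>0. \<exists>\<phi>\<in>molls \<epsilon>. Q (cball x r) \<phi>)"
    by blast
  from bchoice[OF this] obtain R where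
    R: "\<forall>x\<in>K. 0 < R x \<and> cball x (R x) \<subseteq> U \<and> (\<forall>\<epsilon>>0. \<exists>\<phi>\<in>molls \<epsilon>. Q (cball x (R x)) \<phi>)" ..
  have op: "open (ball x (R x / 2))" for x
    by simp
  have "x \<in> ball x (R x / 2)" if "x \<in> K" for x
    using R that by auto
  then have cov: "K \<subseteq> (\<Union>x\<in>K. ball x (R x / 2))"
    by blast
  obtain A where A: "A \<subseteq> K" "finite A" "K \<subseteq> (\<Union>x\<in>A. ball x (R x / 2))"
    using compactE_image[OF assms(4) op cov] by blast
  have RA: "0 < R x" "cball x (R x) \<subseteq> U" "\<forall>\<epsilon>>0. \<exists>\<phi>\<in>molls \<epsilon>. Q (cball x (R x)) \<phi>" if "x \<in> A" for x
    using bspec[OF R subsetD[OF A(1) that]] by simp_all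
  have "\<exists>\<phi>\<in>molls \<epsilon>. \<forall>x\<in>A. Q (cball x (R x / 2)) \<phi>"
    by (rule common_mollifier[where V = "\<lambda>_. U" and R = R and x = "\<lambda>x. x" and Q = "\<lambda>_. Q"])
      (simp_all add: A(2) assms(1,2,6) RA)
  then obtain \<phi> where \<phi>: "\<phi> \<in> molls \<epsilon>" "\<And>x. x \<in> A \<Longrightarrow> Q (cball x (R x / 2)) \<phi>"
    by blast
  have "Q (\<Union>x\<in>A. cball x (R x / 2)) \<phi>"
    by (rule local_property_Union[OF assms(2) A(2), of "\<lambda>x. cball x (R x / 2)"]) (rule \<phi>(2))
  moreover have "K \<subseteq> (\<Union>x\<in>A. cball x (R x / 2))"
    using A(3) by force
  ultimately have "Q K \<phi>"
    by (rule antitoneD[OF local_property_antitone[OF assms(2)]])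
  with \<phi>(1) show ?thesis by blast
qed

lemma fits_imp_admissible:
  assumes "\<phi> \<in> D_o" "fits U K \<phi>"
  shows "admissible U K \<phi>"
  unfolding admissible_def conv_defined_def
proof safe
  fix f x y assume "f \<in> cont_funs U" "x \<in> K"
  then have *: "minus_supp x \<phi> \<subseteq> U" "continuous_on U f"
    using assms(2) by (auto simp: fits_def cont_funs_def)
  then show "integrable lborel (\<lambda>y. f y * \<phi> (x - y))"
    by (intro integrable_conv D_o_test_fun assms(1) continuous_on_subset[OF *(2)])
  assume "\<phi> (x - y) \<noteq> 0"
  then have "y \<in> minus_supp x \<phi>"
    unfolding minus_supp_iff using zero_off_supp[of "x - y" \<phi>] by (rule contrapos_np)
  with * show "y \<in> U" by blast
qed

text \<open>From left to right, the tail of the delta sequence of a closed ball provides mollifiers of every range.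
  From right to left, the mollifiers of range \<open>1 / (m + 1)\<close> for \<open>K\<close> form a delta sequence.\<close>

lemma delta_seqs_iff_germ:
  assumes "open U" "local_property U Q"
  shows "(\<forall>K. compact K \<and> K \<subseteq> U \<longrightarrow> (\<exists>\<delta>\<in>delta_seqs. \<forall>m. admissible U K (\<delta> m) \<longrightarrow> Q K (\<delta> m)))
    \<longleftrightarrow> (\<forall>x\<in>U. germ Q x)" (is "?L \<longleftrightarrow> ?R")
proof
  assume L: ?L
  show ?R
  proof
    fix x assume x: "x \<in> U"
    obtain r where r: "r > 0" "cball x r \<subseteq> U"
      using assms(1)[unfolded open_contains_cball, rule_format, OF x] by blast
    then obtain \<delta> where \<delta>: "\<delta> \<in> delta_seqs" "\<forall>m. admissible U (cball x r) (\<delta> m) \<longrightarrow> Q (cball x r) (\<delta> m)"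
      using L[rule_format, of "cball x r"] by auto
    have "\<exists>\<phi>\<in>molls \<epsilon>. Q (cball x r) \<phi>" if e: "0 < \<epsilon>" for \<epsilon>
    proof -
      have "\<forall>\<^sub>F d in at_right 0. \<forall>\<phi>\<in>molls d. fits U (cball x r) \<phi>"
        using assms(1) r(2) by (intro eventually_molls_fit) auto
      then have "\<forall>\<^sub>F d in at_right 0. 0 < d \<and> (\<forall>\<phi>\<in>molls d. fits U (cball x r) \<phi>)"
        by (intro eventually_conj eventually_at_right_less)
      from eventually_happens'[OF _ this] obtain d where d: "0 < d" "\<And>\<phi>. \<phi> \<in> molls d \<Longrightarrow> fits U (cball x r) \<phi>"
        by (auto simp: trivial_limit_at_right_real)
      obtain m where m: "\<delta> m \<in> molls (min d \<epsilon>)"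
        using eventually_happens[OF delta_seqs_molls[OF \<delta>(1), of "min d \<epsilon>"]] d(1) e by auto
      have "fits U (cball x r) (\<delta> m)"
        using d(2) molls_mono[OF m] by auto
      then have "Q (cball x r) (\<delta> m)"
        by (rule \<delta>(2)[rule_format, OF fits_imp_admissible[OF molls_D_o[OF m]]])
      then show ?thesis
        by (rule bexI[of _ "\<delta> m"]) (use molls_mono[OF m] in simp)
    qed
    with r(1) show "germ Q x" unfolding germ_def by blast
  qed
next
  assume R: ?R
  show ?L
  proof (intro allI impI)
    fix K assume K: "compact K \<and> K \<subseteq> U"
    have "\<exists>\<phi>\<in>molls (1 / real (Suc m)). Q K \<phi>" for m
      by (rule germs_imp_compact[OF assms]) (use R K in simp_all)
    then have "\<forall>m. \<exists>\<phi>. \<phi> \<in> molls (1 / real (Suc m)) \<and> Q K \<phi>"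
      by blast
    from choice[OF this] obtain \<delta> where \<delta>: "\<forall>m. \<delta> m \<in> molls (1 / real (Suc m)) \<and> Q K (\<delta> m)" ..
    then have "\<delta> \<in> delta_seqs"
      by (intro delta_seqsI) simp
    with \<delta> show "\<exists>\<delta>\<in>delta_seqs. \<forall>m. admissible U K (\<delta> m) \<longrightarrow> Q K (\<delta> m)"
      by (intro bexI[of _ \<delta>]) simp_all
  qed
qed

definition conv_convergent :: "(nat \<Rightarrow> 'a::euclidean_space \<Rightarrow> real) \<Rightarrow> 'a set \<Rightarrow> ('a \<Rightarrow> real) \<Rightarrow> bool" where
  "conv_convergent u S \<phi> \<longleftrightarrow> uniformly_convergent_on S (\<lambda>n. conv (u n) \<phi>)"

definition conv_null :: "(nat \<Rightarrow> 'a::euclidean_space \<Rightarrow> real) \<Rightarrow> 'a set \<Rightarrow> ('a \<Rightarrow> real) \<Rightarrow> bool" where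
  "conv_null u S \<phi> \<longleftrightarrow> uniform_limit S (\<lambda>n. conv (u n) \<phi>) (\<lambda>_. 0) sequentially"

lemma continuous_limit_conv:
  assumes "\<And>n. continuous_on U (u n)" "compact S" "\<phi> \<in> D_o" "fits U S \<phi>"
    and "uniform_limit S (\<lambda>n. conv (u n) \<phi>) h sequentially"
  shows "continuous_on S h"
  by (rule uniform_limit_theorem[OF _ assms(5)])
    (auto intro!: always_eventually continuous_conv_local[OF D_o_test_fun] assms)

text \<open>Averaging with \<open>\<psi>\<close> does not increase the distance between \<open>conv (u n) \<phi>\<close> and its uniform limit \<open>h\<close>.\<close>

lemma uniform_limit_conv:
  assumes "\<And>n. continuous_on U (u n)" "compact S" "\<phi> \<in> D_o" "\<psi> \<in> D_o" "fits U S \<phi>" "fits S T \<psi>"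
    and lim: "uniform_limit S (\<lambda>n. conv (u n) \<phi>) h sequentially"
  shows "uniform_limit T (\<lambda>n. conv (u n) (conv \<phi> \<psi>)) (conv h \<psi>) sequentially"
proof (rule uniform_limitI)
  fix e :: real assume "0 < e"
  have h: "continuous_on S h"
    using continuous_limit_conv[OF assms(1-3,5) lim] .
  have "\<forall>\<^sub>F n in sequentially. \<forall>y\<in>S. dist (conv (u n) \<phi> y) (h y) < e / 2"
    using uniform_limitD[OF lim, of "e / 2"] \<open>0 < e\<close> by simp
  then show "\<forall>\<^sub>F n in sequentially. \<forall>x\<in>T. dist (conv (u n) (conv \<phi> \<psi>) x) (conv h \<psi> x) < e"
  proof eventually_elim
    case (elim n)
    show ?case
    proof
      fix x assume x: "x \<in> T"
      have sub: "minus_supp x \<psi> \<subseteq> S" using fitsD[OF assms(6) x] .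
      have "conv (u n) (conv \<phi> \<psi>) x = conv (conv (u n) \<phi>) \<psi> x"
        using conv_assoc[OF D_o_test_fun D_o_test_fun assms(1,5,6) x] assms(3,4) by simp
      moreover have "\<bar>conv (conv (u n) \<phi>) \<psi> x - conv h \<psi> x\<bar> \<le> e / 2"
      proof (rule conv_diff_bound[OF assms(4)])
        show "continuous_on (minus_supp x \<psi>) (conv (u n) \<phi>)"
          using continuous_conv_local[OF D_o_test_fun assms(1,2,5)] assms(3) sub continuous_on_subset by blast
        show "continuous_on (minus_supp x \<psi>) h"
          using h sub continuous_on_subset by blast
        fix y assume "y \<in> minus_supp x \<psi>"
        then show "\<bar>conv (u n) \<phi> y - h y\<bar> \<le> e / 2"
          using elim sub by (force simp: dist_real_def)
      qed
      ultimately show "dist (conv (u n) (conv \<phi> \<psi>) x) (conv h \<psi> x) < e"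
        using \<open>0 < e\<close> by (simp add: dist_real_def)
    qed
  qed
qed

lemma conv_zero: "conv (\<lambda>_. 0) \<phi> = (\<lambda>_. 0)"
  by (simp add: conv_def fun_eq_iff)

lemma local_property_null:
  assumes "\<And>n. continuous_on U (u n)"
  shows "local_property U (conv_null u)"
  unfolding local_property_def antitone_def
proof (intro conjI allI impI; (elim conjE)?)
  fix S T \<phi> \<psi> assume *: "compact S" "\<phi> \<in> D_o" "\<psi> \<in> D_o" "fits U S \<phi>" "fits S T \<psi>" "conv_null u S \<phi>"
  show "conv_null u T (conv \<phi> \<psi>)"
    using uniform_limit_conv[where u=u, OF assms *(1-5), of "\<lambda>_. 0"] *(6) by (simp add: conv_null_def conv_zero)
qed (auto simp: conv_null_def uniform_limit_on_Un intro: uniform_limit_on_subset)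

lemma local_property_convergent:
  assumes "\<And>n. continuous_on U (u n)"
  shows "local_property U (conv_convergent u)"
  unfolding local_property_def antitone_def
proof (intro conjI allI impI; (elim conjE)?)
  fix S T \<phi> \<psi> assume *: "compact S" "\<phi> \<in> D_o" "\<psi> \<in> D_o" "fits U S \<phi>" "fits S T \<psi>" "conv_convergent u S \<phi>"
  then show "conv_convergent u T (conv \<phi> \<psi>)"
    using uniform_limit_conv[where u=u, OF assms *(1-5)] by (auto simp: conv_convergent_def uniformly_convergent_on_def)
next
  fix S T \<phi> assume "conv_convergent u S \<phi>" "conv_convergent u T \<phi>"
  then show "conv_convergent u (S \<union> T) \<phi>"
    by (simp add: conv_convergent_def uniformly_convergent_uniform_limit_iff uniform_limit_on_Un)
qed (auto simp: conv_convergent_def intro: uniformly_convergent_on_subset)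

lemma conv_cong_fits:
  assumes "fits V S \<phi>" "\<And>y. y \<in> V \<Longrightarrow> f y = g y" "x \<in> S"
  shows "conv f \<phi> x = conv g \<phi> x"
  using assms fitsD by (intro conv_cong) blast

lemma conv_null_cong:
  assumes "fits V S \<phi>" "\<And>n y. y \<in> V \<Longrightarrow> u n y = v n y"
  shows "conv_null u S \<phi> \<longleftrightarrow> conv_null v S \<phi>"
  unfolding conv_null_def
  by (intro uniform_limit_cong' conv_cong_fits[OF assms(1)] assms refl)

lemma conv_convergent_cong:
  assumes "fits V S \<phi>" "\<And>n y. y \<in> V \<Longrightarrow> u n y = v n y"
  shows "conv_convergent u S \<phi> \<longleftrightarrow> conv_convergent v S \<phi>"
  unfolding conv_convergent_def uniformly_convergent_on_def
  by (intro ex_cong1 uniform_limit_cong' conv_cong_fits[OF assms(1)] assms refl)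

lemma antitone_null: "antitone (conv_null u)"
  unfolding antitone_def conv_null_def by (auto intro: uniform_limit_on_subset)

lemma antitone_convergent: "antitone (conv_convergent u)"
  unfolding antitone_def conv_convergent_def by (auto intro: uniformly_convergent_on_subset)

lemma germ_null_cong:
  assumes "germ (conv_null u) x" "open V" "x \<in> V" "\<And>n y. y \<in> V \<Longrightarrow> u n y = v n y"
  shows "germ (conv_null v) x"
  by (rule germ_mono[OF assms(1) antitone_null assms(2,3)]) (use conv_null_cong assms(4) in blast)

lemma germ_convergent_cong:
  assumes "germ (conv_convergent u) x" "open V" "x \<in> V" "\<And>n y. y \<in> V \<Longrightarrow> u n y = v n y"
  shows "germ (conv_convergent v) x"
  by (rule germ_mono[OF assms(1) antitone_convergent assms(2,3)]) (use conv_convergent_cong assms(4) in blast)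

lemma germ_null_zero: "germ (conv_null (\<lambda>_ _. 0)) x"
  unfolding germ_def conv_null_def conv_zero
  by (metis molls_nonempty uniform_limit_const zero_less_one)

text \<open>The two sequences are null for different mollifiers; \<open>germ_conj\<close> supplies common ones. This is what makes
  equivalence of fundamental sequences transitive.\<close>

lemma germ_null_diff:
  assumes "open U" "x \<in> U" "\<And>n. continuous_on U (u n)" "\<And>n. continuous_on U (v n)"
    and "germ (conv_null u) x" "germ (conv_null v) x"
  shows "germ (conv_null (\<lambda>n y. u n y - v n y)) x"
proof (rule germ_mono[OF germ_conj])
  fix S \<phi> assume *: "\<phi> \<in> D_o" "fits U S \<phi>" "conv_null u S \<phi> \<and> conv_null v S \<phi>"
  have "conv (\<lambda>y. u n y - v n y) \<phi> y = conv (u n) \<phi> y - conv (v n) \<phi> y" if "y \<in> S" for n y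
    using *(1) fitsD[OF *(2) that] assms(3,4) continuous_on_subset by (intro conv_diff D_o_test_fun) blast+
  moreover have "uniform_limit S (\<lambda>n y. conv (u n) \<phi> y - conv (v n) \<phi> y) (\<lambda>y. 0 - 0) sequentially"
    using *(3) unfolding conv_null_def by (intro uniform_limit_minus) auto
  ultimately show "conv_null (\<lambda>n y. u n y - v n y) S \<phi>"
    unfolding conv_null_def by (simp cong: uniform_limit_cong')
qed (use assms local_property_null in \<open>auto simp: antitone_def intro: antitoneD[OF antitone_null]\<close>)

section \<open>Boehmians by germs\<close>

lemma cont_funs_continuous: "f \<in> cont_funs U \<Longrightarrow> V \<subseteq> U \<Longrightarrow> continuous_on V f"
  unfolding cont_funs_def using continuous_on_subset by blast

lemma fundamental_iff:
  assumes "open U"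
  shows "f \<in> fundamental_seqs U \<longleftrightarrow> (\<forall>n. f n \<in> cont_funs U) \<and> (\<forall>x\<in>U. germ (conv_convergent f) x)"
proof (cases "\<forall>n. f n \<in> cont_funs U")
  case True
  then have "local_property U (conv_convergent f)"
    by (intro local_property_convergent cont_funs_continuous) auto
  from delta_seqs_iff_germ[OF assms this] True show ?thesis
    by (simp add: fundamental_seqs_def conv_convergent_def)
qed (unfold fundamental_seqs_def, blast)

lemma fundamental_continuous: "f \<in> fundamental_seqs U \<Longrightarrow> V \<subseteq> U \<Longrightarrow> continuous_on V (f n)"
  unfolding fundamental_seqs_def using cont_funs_continuous by blast

lemma boehmian_rel_iff:
  assumes "open U"
  shows "(f, g) \<in> boehmian_rel U \<longleftrightarrow> f \<in> fundamental_seqs U \<and> g \<in> fundamental_seqs U \<and>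
    (\<forall>x\<in>U. germ (conv_null (\<lambda>n y. f n y - g n y)) x)"
proof (cases "f \<in> fundamental_seqs U \<and> g \<in> fundamental_seqs U")
  case True
  let ?d = "\<lambda>n. \<lambda>x\<in>U. f n x - g n x"
  have "continuous_on U (?d n)" for n
    using True fundamental_continuous[of f U U n] fundamental_continuous[of g U U n]
    by (auto intro!: continuous_on_diff cong: continuous_on_cong)
  then have "local_property U (conv_null ?d)"
    by (rule local_property_null)
  from delta_seqs_iff_germ[OF assms this] True
  have "(f, g) \<in> boehmian_rel U \<longleftrightarrow> (\<forall>x\<in>U. germ (conv_null ?d) x)"
    by (simp add: boehmian_rel_def conv_null_def)
  also have "\<dots> \<longleftrightarrow> (\<forall>x\<in>U. germ (conv_null (\<lambda>n y. f n y - g n y)) x)"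
    using assms by (auto elim!: germ_null_cong[where V=U])
  finally show ?thesis using True by simp
qed (auto simp: boehmian_rel_def)

lemma equiv_boehmian_rel:
  assumes "open U"
  shows "equiv (fundamental_seqs U) (boehmian_rel U)"
proof (rule equivI)
  show "boehmian_rel U \<subseteq> fundamental_seqs U \<times> fundamental_seqs U"
    by (auto simp: boehmian_rel_def)
  show "refl_on (fundamental_seqs U) (boehmian_rel U)"
    by (auto simp: refl_on_def boehmian_rel_iff[OF assms] germ_null_zero)
  have sym: "(g, f) \<in> boehmian_rel U" if "(f, g) \<in> boehmian_rel U" for f g
    using that germ_null_diff[OF assms, of _ "\<lambda>_ _. 0" "\<lambda>n y. f n y - g n y"] germ_null_zero
      fundamental_continuous[of f U U] fundamental_continuous[of g U U]
    by (auto simp: boehmian_rel_iff[OF assms] continuous_on_diff)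
  then show "sym (boehmian_rel U)"
    by (auto intro: symI)
  show "trans (boehmian_rel U)"
  proof (rule transI)
    fix f g h assume "(f, g) \<in> boehmian_rel U" "(g, h) \<in> boehmian_rel U"
    with sym have "(f, g) \<in> boehmian_rel U" "(h, g) \<in> boehmian_rel U"
      by auto
    moreover have "(\<lambda>n y. f n y - g n y - (h n y - g n y)) = (\<lambda>n y. f n y - h n y)"
      by simp
    ultimately show "(f, h) \<in> boehmian_rel U"
      using germ_null_diff[OF assms, of _ "\<lambda>n y. f n y - g n y" "\<lambda>n y. h n y - g n y"]
        fundamental_continuous[of f U U] fundamental_continuous[of g U U] fundamental_continuous[of h U U]
      by (simp add: boehmian_rel_iff[OF assms] continuous_on_diff)
  qed
qed

abbreviation restrict_seq :: "(nat \<Rightarrow> 'a \<Rightarrow> real) \<Rightarrow> 'a set \<Rightarrow> nat \<Rightarrow> 'a \<Rightarrow> real" where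
  "restrict_seq f V \<equiv> \<lambda>n. restrict (f n) V"

abbreviation boehmian_class :: "'a::euclidean_space set \<Rightarrow> (nat \<Rightarrow> 'a \<Rightarrow> real) \<Rightarrow> 'a boehmian" where
  "boehmian_class U f \<equiv> boehmian_rel U `` {f}"

lemma fundamental_restrict:
  assumes "open U" "open V" "V \<subseteq> U" "f \<in> fundamental_seqs U"
  shows "restrict_seq f V \<in> fundamental_seqs V"
proof -
  have "restrict (f n) V \<in> cont_funs V" for n
    using fundamental_continuous[OF assms(4,3), of n] by (auto simp: cont_funs_def cong: continuous_on_cong)
  moreover have "germ (conv_convergent (restrict_seq f V)) x" if "x \<in> V" for x
    by (rule germ_convergent_cong[where u=f and V=V])
      (use assms that in \<open>auto simp: fundamental_iff[OF assms(1)]\<close>)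
  ultimately show ?thesis
    by (simp add: fundamental_iff[OF assms(2)])
qed

lemma boehmian_rel_restrict:
  assumes "open U" "open V" "V \<subseteq> U" "(f, g) \<in> boehmian_rel U"
  shows "(restrict_seq f V, restrict_seq g V) \<in> boehmian_rel V"
proof -
  have *: "f \<in> fundamental_seqs U" "g \<in> fundamental_seqs U" "\<And>x. x \<in> U \<Longrightarrow> germ (conv_null (\<lambda>n y. f n y - g n y)) x"
    using assms(4) by (auto simp: boehmian_rel_iff[OF assms(1)])
  have "germ (conv_null (\<lambda>n y. restrict (f n) V y - restrict (g n) V y)) x" if "x \<in> V" for x
    by (rule germ_null_cong[OF *(3), where V=V]) (use assms that in auto)
  then show ?thesis
    using fundamental_restrict[OF assms(1-3)] * by (simp add: boehmian_rel_iff[OF assms(2)])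
qed

lemma restrict_boehmian_class:
  assumes "open U" "open V" "V \<subseteq> U" "f \<in> fundamental_seqs U"
  shows "boehmian_restrict V (boehmian_class U f) = boehmian_class V (restrict_seq f V)"
proof -
  have "boehmian_class V (restrict_seq g V) = boehmian_class V (restrict_seq f V)" if "g \<in> boehmian_class U f" for g
    using equiv_class_eq[OF equiv_boehmian_rel[OF assms(2)]] boehmian_rel_restrict[OF assms(1-3)] that by blast
  moreover have "f \<in> boehmian_class U f"
    using equiv_class_self[OF equiv_boehmian_rel[OF assms(1)] assms(4)] .
  ultimately show ?thesis
    unfolding boehmian_restrict_def by blast
qed

lemma boehmiansE:
  assumes "F \<in> boehmians U"
  obtains f where "f \<in> fundamental_seqs U" "F = boehmian_class U f"
  using assms unfolding boehmians_def by (rule quotientE)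

lemma boehmian_class_in: "f \<in> fundamental_seqs U \<Longrightarrow> boehmian_class U f \<in> boehmians U"
  unfolding boehmians_def by (rule quotientI)

lemma boehmian_class_eq_iff:
  assumes "open U" "f \<in> fundamental_seqs U" "g \<in> fundamental_seqs U"
  shows "boehmian_class U f = boehmian_class U g \<longleftrightarrow> (\<forall>x\<in>U. germ (conv_null (\<lambda>n y. f n y - g n y)) x)"
  using eq_equiv_class_iff[OF equiv_boehmian_rel[OF assms(1)] assms(2,3)] assms
  by (simp add: boehmian_rel_iff[OF assms(1)])

text \<open>Equality of restrictions is a statement about germs of the unrestricted representatives, which is the form in
  which gluing and locality use it.\<close>

lemma restrict_class_eq_iff:
  assumes "open U" "open U'" "open V" "V \<subseteq> U" "V \<subseteq> U'" "f \<in> fundamental_seqs U" "g \<in> fundamental_seqs U'"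
  shows "boehmian_restrict V (boehmian_class U f) = boehmian_restrict V (boehmian_class U' g) \<longleftrightarrow>
    (\<forall>x\<in>V. germ (conv_null (\<lambda>n y. f n y - g n y)) x)"
proof -
  have "germ (conv_null (\<lambda>n y. restrict (f n) V y - restrict (g n) V y)) x \<longleftrightarrow>
      germ (conv_null (\<lambda>n y. f n y - g n y)) x" if "x \<in> V" for x
    using that assms(3) by (auto elim!: germ_null_cong[where V=V])
  moreover have "restrict_seq f V \<in> fundamental_seqs V" "restrict_seq g V \<in> fundamental_seqs V"
    by (rule fundamental_restrict[OF assms(1,3,4,6)], rule fundamental_restrict[OF assms(2,3,5,7)])
  ultimately show ?thesis
    unfolding restrict_boehmian_class[OF assms(1,3,4,6)] restrict_boehmian_class[OF assms(2,3,5,7)]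
    by (simp add: boehmian_class_eq_iff[OF assms(3)] del: restrict_apply)
qed

lemma restrict_self: "f \<in> fundamental_seqs V \<Longrightarrow> restrict_seq f V = f"
  by (auto simp: fundamental_seqs_def cont_funs_def extensional_restrict)

section \<open>Gluing\<close>

lemma cball_subset_cball: "dist x y + r \<le> s \<Longrightarrow> cball y r \<subseteq> cball (x::'a::metric_space) s"
proof
  fix z assume "dist x y + r \<le> s" "z \<in> cball y r"
  then show "z \<in> cball x s"
    using dist_triangle[of x z y] by simp
qed

lemma conv_nullI:
  assumes "uniform_limit S w (\<lambda>_. 0) sequentially" "\<And>n y. y \<in> S \<Longrightarrow> conv (u n) \<phi> y = w n y"
  shows "conv_null u S \<phi>"
  unfolding conv_null_def using assms(1) by (subst uniform_limit_cong'[OF assms(2) refl])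

text \<open>The value \<open>conv f \<psi> x\<close> differs from \<open>f x\<close> by at most the oscillation of \<open>f\<close> over the range of \<open>\<psi>\<close>, so continuous
  functions are recovered from their mollifications.\<close>

lemma eq_if_conv_eq:
  assumes "0 < s" "continuous_on (cball x s) f" "continuous_on (cball x s) g"
    and "\<And>\<eta>. 0 < \<eta> \<Longrightarrow> \<exists>\<psi>\<in>molls \<eta>. conv f \<psi> x = conv g \<psi> x"
  shows "f x = g x"
proof (rule ccontr)
  assume "f x \<noteq> g x"
  define d where "d = (\<lambda>y. f y - g y)"
  define e where "e = \<bar>d x\<bar> / 2"
  have e: "0 < e" using \<open>f x \<noteq> g x\<close> by (simp add: e_def d_def)
  have "continuous_on (cball x s) d"
    unfolding d_def by (intro continuous_on_diff assms(2,3))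
  then obtain \<eta> where \<eta>: "0 < \<eta>" "\<forall>y\<in>cball x s. dist y x < \<eta> \<longrightarrow> dist (d y) (d x) \<le> e"
    unfolding continuous_on_iff using e assms(1) by (metis centre_in_cball less_imp_le)
  have "0 < min \<eta> s" using \<eta>(1) assms(1) by simp
  then obtain \<psi> where \<psi>: "\<psi> \<in> molls (min \<eta> s)" "conv f \<psi> x = conv g \<psi> x"
    using assms(4) by blast
  have sub: "minus_supp x \<psi> \<subseteq> ball x (min \<eta> s)"
    using minus_supp_molls[OF \<psi>(1)] .
  then have sub': "minus_supp x \<psi> \<subseteq> cball x s"
    by auto
  have "conv d \<psi> x = 0"
    unfolding d_def
    by (subst conv_diff[OF molls_test_fun[OF \<psi>(1)] continuous_on_subset[OF assms(2) sub']
          continuous_on_subset[OF assms(3) sub']]) (simp add: \<psi>(2))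
  moreover have "\<bar>conv d \<psi> x - d x\<bar> \<le> e"
  proof (rule conv_bound[OF molls_D_o[OF \<psi>(1)]])
    show "continuous_on (minus_supp x \<psi>) d"
      unfolding d_def by (intro continuous_on_diff continuous_on_subset[OF assms(2) sub']
          continuous_on_subset[OF assms(3) sub'])
    fix y assume "y \<in> minus_supp x \<psi>"
    then have "y \<in> ball x (min \<eta> s)" using sub by blast
    then show "\<bar>d y - d x\<bar> \<le> e"
      using \<eta>(2) by (auto simp: dist_commute dist_real_def)
  qed
  ultimately show False using e by (simp add: e_def)
qed

text \<open>\<open>p\<close> is uniformly continuous on the larger ball, and \<open>conv p (\<phi> j) y\<close> is a mean of its values near \<open>y\<close>.\<close>

lemma uniform_limit_conv_mollifiers:
  assumes "0 < a" "continuous_on (cball x (r + a)) p" "\<And>j. \<phi> j \<in> molls (\<rho> j)" "\<rho> \<longlonglongrightarrow> 0"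
  shows "uniform_limit (cball x r) (\<lambda>j. conv p (\<phi> j)) p sequentially"
proof (rule uniform_limitI)
  fix e :: real assume e: "0 < e"
  have "uniformly_continuous_on (cball x (r + a)) p"
    by (intro compact_uniformly_continuous assms(2) compact_cball)
  then obtain d where d: "0 < d" "\<And>y z. y \<in> cball x (r + a) \<Longrightarrow> z \<in> cball x (r + a) \<Longrightarrow> dist z y < d \<Longrightarrow> dist (p z) (p y) < e / 2"
    unfolding uniformly_continuous_on_def using e by (metis half_gt_zero)
  have "\<forall>\<^sub>F j in sequentially. \<rho> j < min a d"
    using assms(1,4) d(1) by (intro order_tendstoD) auto
  then show "\<forall>\<^sub>F j in sequentially. \<forall>y\<in>cball x r. dist (conv p (\<phi> j) y) (p y) < e"
  proof eventually_elim
    case (elim j)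
    show ?case
    proof
      fix y assume y: "y \<in> cball x r"
      have sub: "minus_supp y (\<phi> j) \<subseteq> ball y (\<rho> j)"
        by (rule minus_supp_molls[OF assms(3)])
      have "cball y (\<rho> j) \<subseteq> cball x (r + a)"
        by (rule cball_subset_cball) (use y elim in auto)
      then have sub': "minus_supp y (\<phi> j) \<subseteq> cball x (r + a)"
        using sub ball_subset_cball[of y "\<rho> j"] by blast
      have "\<bar>conv p (\<phi> j) y - p y\<bar> \<le> e / 2"
      proof (rule conv_bound[OF molls_D_o[OF assms(3)] continuous_on_subset[OF assms(2) sub']])
        fix z assume z: "z \<in> minus_supp y (\<phi> j)"
        then have "z \<in> ball y (\<rho> j)" "z \<in> cball x (r + a)" using sub sub' by blast+
        moreover have "y \<in> cball x (r + a)" using y assms(1) by simp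
        ultimately show "\<bar>p z - p y\<bar> \<le> e / 2"
          using d(2)[of y z] elim by (simp add: dist_commute dist_real_def abs_minus_commute)
      qed
      then show "dist (conv p (\<phi> j) y) (p y) < e"
        using e by (simp add: dist_real_def)
    qed
  qed
qed

lemma conv_tendsto:
  assumes "\<psi> \<in> D_o" "fits S {x} \<psi>" "\<And>n. continuous_on S (w n)" "uniform_limit S w h sequentially"
  shows "(\<lambda>n. conv (w n) \<psi> x) \<longlonglongrightarrow> conv h \<psi> x"
proof (rule LIMSEQ_I)
  fix e :: real assume e: "0 < e"
  have sub: "minus_supp x \<psi> \<subseteq> S" using fitsD[OF assms(2)] by simp
  have h: "continuous_on S h"
    by (rule uniform_limit_theorem[OF _ assms(4)]) (simp_all add: assms(3))
  have "\<forall>\<^sub>F n in sequentially. \<forall>y\<in>S. dist (w n y) (h y) < e / 2"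
    using uniform_limitD[OF assms(4), of "e / 2"] e by simp
  then have "\<forall>\<^sub>F n in sequentially. norm (conv (w n) \<psi> x - conv h \<psi> x) < e"
  proof eventually_elim
    case (elim n)
    have "\<bar>conv (w n) \<psi> x - conv h \<psi> x\<bar> \<le> e / 2"
      by (rule conv_diff_bound[OF assms(1) continuous_on_subset[OF assms(3) sub] continuous_on_subset[OF h sub]])
        (use elim sub in \<open>force simp: dist_real_def\<close>)
    then show ?case using e by simp
  qed
  then show "\<exists>N. \<forall>n\<ge>N. norm (conv (w n) \<psi> x - conv h \<psi> x) < e"
    by (simp add: eventually_sequentially)
qed

text \<open>Mollifying \<open>h\<close> and \<open>g\<close> gives the same value at \<open>x\<close>, because \<open>w n - g\<close> becomes null after mollification.\<close>

lemma uniform_limit_eq_if_germ_null: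
  assumes "0 < s" "\<And>n. continuous_on (cball x s) (w n)" "continuous_on (cball x s) g"
    and "uniform_limit (cball x s) w h sequentially"
    and "germ (conv_null (\<lambda>n y. w n y - g y)) x"
  shows "h x = g x"
proof (rule eq_if_conv_eq[OF assms(1) _ assms(3)])
  show "continuous_on (cball x s) h"
    by (rule uniform_limit_theorem[OF _ assms(4)]) (simp_all add: assms(2))
  fix \<eta> :: real assume \<eta>: "0 < \<eta>"
  obtain r where r: "0 < r" "\<forall>\<epsilon>>0. \<exists>\<phi>\<in>molls \<epsilon>. conv_null (\<lambda>n y. w n y - g y) (cball x r) \<phi>"
    using assms(5) unfolding germ_def by blast
  have "0 < min \<eta> s" using \<eta> assms(1) by simp
  then obtain \<psi> where \<psi>: "\<psi> \<in> molls (min \<eta> s)" "conv_null (\<lambda>n y. w n y - g y) (cball x r) \<psi>"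
    using r(2) by blast
  have fit: "fits (cball x s) {x} \<psi>"
    by (rule fits_molls[OF \<psi>(1)]) auto
  then have sub: "minus_supp x \<psi> \<subseteq> cball x s" using fitsD by blast
  have "(\<lambda>n. conv (\<lambda>y. w n y - g y) \<psi> x) \<longlonglongrightarrow> 0"
    using tendsto_uniform_limitI[OF \<psi>(2)[unfolded conv_null_def], of x] r(1) by simp
  moreover have "conv (\<lambda>y. w n y - g y) \<psi> x = conv (w n) \<psi> x - conv g \<psi> x" for n
    by (rule conv_diff[OF molls_test_fun[OF \<psi>(1)] continuous_on_subset[OF assms(2) sub]
          continuous_on_subset[OF assms(3) sub]])
  ultimately have "(\<lambda>n. conv (w n) \<psi> x - conv g \<psi> x) \<longlonglongrightarrow> 0"
    by simp
  then have "(\<lambda>n. conv (w n) \<psi> x) \<longlonglongrightarrow> conv g \<psi> x"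
    by (simp add: LIM_zero_iff)
  with conv_tendsto[OF molls_D_o[OF \<psi>(1)] fit assms(2,4)]
  have "conv h \<psi> x = conv g \<psi> x"
    by (rule LIMSEQ_unique)
  with molls_mono[OF \<psi>(1)] show "\<exists>\<psi>\<in>molls \<eta>. conv h \<psi> x = conv g \<psi> x"
    by (intro bexI[of _ \<psi>]) auto
qed

text \<open>If \<open>u\<close> and \<open>v\<close> represent the same Boehmian \<open>F\<close> near \<open>x\<close> and \<open>v\<^sub>n * \<phi>\<close> has the limit \<open>h\<close>, then \<open>h\<close> deserves the name
  \<open>F * \<phi>\<close>. The sequence \<open>u\<^sub>n * \<phi>\<close> need not converge, but it approaches \<open>h\<close> in the sense of germs, because
  \<open>(u\<^sub>n * \<phi> - h) * \<psi> = (u\<^sub>n - v\<^sub>n) * \<psi> * \<phi> + (v\<^sub>n * \<phi> - h) * \<psi>\<close>.\<close>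

lemma germ_null_transfer:
  assumes "0 < r" "open V" "cball x (a + r) \<subseteq> V" "\<phi> \<in> molls a"
    and u: "\<And>n. continuous_on V (u n)" and v: "\<And>n. continuous_on V (v n)"
    and null: "\<And>y. y \<in> V \<Longrightarrow> germ (conv_null (\<lambda>n z. u n z - v n z)) y"
    and lim: "uniform_limit (cball x r) (\<lambda>n. conv (v n) \<phi>) h sequentially"
  shows "germ (conv_null (\<lambda>n z. conv (u n) \<phi> z - h z)) x"
  unfolding germ_def
proof (intro exI[of _ "r / 2"] conjI allI impI)
  show "0 < r / 2" using assms(1) by simp
  fix \<epsilon> :: real assume \<epsilon>: "0 < \<epsilon>"
  define K where "K = cball x (a + r)"
  note \<phi> = molls_D_o[OF assms(4)] molls_test_fun[OF assms(4)]
  have fit\<phi>: "fits K (cball x r) \<phi>"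
    unfolding K_def by (rule fits_cball[OF assms(4)]) simp
  then have fitV: "fits V (cball x r) \<phi>"
    by (rule fits_subset) (use assms(3) in \<open>simp_all add: K_def\<close>)
  have h: "continuous_on (cball x r) h"
    by (rule continuous_limit_conv[OF v compact_cball \<phi>(1) fitV lim])
  have "\<forall>\<^sub>F d in at_right 0. (\<forall>\<psi>\<in>molls d. fits V K \<psi>) \<and> 0 < d"
    using assms(2,3) unfolding K_def
    by (intro eventually_conj eventually_molls_fit compact_cball eventually_at_right_less) auto
  from eventually_happens'[OF _ this] obtain d where d: "0 < d" "\<forall>\<psi>\<in>molls d. fits V K \<psi>"
    by (auto simp: trivial_limit_at_right_real)
  define e where "e = min \<epsilon> (min d (r / 2))"
  have "0 < e" using \<epsilon> d(1) assms(1) by (simp add: e_def)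
  have uv: "continuous_on V (\<lambda>z. u n z - v n z)" for n
    by (intro continuous_on_diff u v)
  have "\<exists>\<psi>\<in>molls e. conv_null (\<lambda>n z. u n z - v n z) K \<psi>"
    by (rule germs_imp_compact[OF assms(2) local_property_null[OF uv] null])
      (use assms(3) \<open>0 < e\<close> in \<open>auto simp: K_def\<close>)
  then obtain \<psi> where \<psi>: "\<psi> \<in> molls e" "conv_null (\<lambda>n z. u n z - v n z) K \<psi>"
    by blast
  note \<psi>' = molls_D_o[OF \<psi>(1)] molls_test_fun[OF \<psi>(1)]
  have "\<psi> \<in> molls d" "\<psi> \<in> molls (r / 2)" "\<psi> \<in> molls \<epsilon>"
    using molls_mono[OF \<psi>(1)] by (simp_all add: e_def)
  have fit\<psi>: "fits (cball x r) (cball x (r / 2)) \<psi>"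
    by (rule fits_cball[OF \<open>\<psi> \<in> molls (r / 2)\<close>]) simp
  have fitK: "fits V K \<psi>" using d(2) \<open>\<psi> \<in> molls d\<close> by blast
  have comm: "conv \<psi> \<phi> = conv \<phi> \<psi>" by (rule conv_commute[OF \<psi>'(2) \<phi>(2)])
  have "uniform_limit (cball x r) (\<lambda>n. conv (\<lambda>z. u n z - v n z) (conv \<psi> \<phi>)) (conv (\<lambda>_. 0) \<phi>) sequentially"
    by (rule uniform_limit_conv[where u = "\<lambda>n z. u n z - v n z", OF uv _ \<psi>'(1) \<phi>(1) fitK fit\<phi>])
      (use \<psi>(2) in \<open>simp_all add: conv_null_def K_def\<close>)
  then have l1: "uniform_limit (cball x (r / 2)) (\<lambda>n. conv (\<lambda>z. u n z - v n z) (conv \<phi> \<psi>)) (\<lambda>_. 0) sequentially"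
    unfolding comm conv_zero by (rule uniform_limit_on_subset) (use assms(1) in auto)
  have l2: "uniform_limit (cball x (r / 2)) (\<lambda>n. conv (v n) (conv \<phi> \<psi>)) (conv h \<psi>) sequentially"
    by (rule uniform_limit_conv[OF v compact_cball \<phi>(1) \<psi>'(1) fitV fit\<psi> lim])
  have "conv (\<lambda>z. conv (u n) \<phi> z - h z) \<psi> y =
      conv (\<lambda>z. u n z - v n z) (conv \<phi> \<psi>) y + (conv (v n) (conv \<phi> \<psi>) y - conv h \<psi> y)"
    if y: "y \<in> cball x (r / 2)" for n y
  proof -
    have sub: "minus_supp y \<psi> \<subseteq> cball x r" using fitsD[OF fit\<psi> y] .
    have "fits V (cball x (r / 2)) (conv \<phi> \<psi>)"
      by (rule fits_trans[OF fitV fit\<psi> \<phi>(2) \<psi>'(2)])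
    then have sub': "minus_supp y (conv \<phi> \<psi>) \<subseteq> V" using fitsD y by blast
    have "conv (\<lambda>z. conv (u n) \<phi> z - h z) \<psi> y = conv (conv (u n) \<phi>) \<psi> y - conv h \<psi> y"
      by (rule conv_diff[OF \<psi>'(2)])
        (rule continuous_on_subset[OF continuous_conv_local[OF \<phi>(2) u compact_cball fitV] sub]
           continuous_on_subset[OF h sub])+
    also have "conv (conv (u n) \<phi>) \<psi> y = conv (u n) (conv \<phi> \<psi>) y"
      by (rule conv_assoc[OF \<phi>(2) \<psi>'(2) u fitV fit\<psi> y])
    also have "conv (\<lambda>z. u n z - v n z) (conv \<phi> \<psi>) y = conv (u n) (conv \<phi> \<psi>) y - conv (v n) (conv \<phi> \<psi>) y"
      by (rule conv_diff[OF test_fun_conv[OF \<phi>(2) \<psi>'(2)] continuous_on_subset[OF u sub'] continuous_on_subset[OF v sub']])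
    then have "conv (u n) (conv \<phi> \<psi>) y = conv (\<lambda>z. u n z - v n z) (conv \<phi> \<psi>) y + conv (v n) (conv \<phi> \<psi>) y"
      by simp
    finally show ?thesis by simp
  qed
  moreover have "uniform_limit (cball x (r / 2)) (\<lambda>n y. conv (\<lambda>z. u n z - v n z) (conv \<phi> \<psi>) y +
      (conv (v n) (conv \<phi> \<psi>) y - conv h \<psi> y)) (\<lambda>y. 0 + (conv h \<psi> y - conv h \<psi> y)) sequentially"
    by (intro uniform_limit_add uniform_limit_minus l1 l2 uniform_limit_const)
  ultimately have "conv_null (\<lambda>n z. conv (u n) \<phi> z - h z) (cball x (r / 2)) \<psi>"
    by (intro conv_nullI) simp_all
  with \<open>\<psi> \<in> molls \<epsilon>\<close> show "\<exists>\<psi>\<in>molls \<epsilon>. conv_null (\<lambda>n z. conv (u n) \<phi> z - h z) (cball x (r / 2)) \<psi>"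
    by blast
qed

text \<open>With \<open>F\<close> the Boehmian of \<open>u\<close>, the assumptions say that \<open>g = F * \<phi>\<close> (in the sense of germs) and \<open>p = F * \<delta>\<close> (as a
  uniform limit), so the claim is \<open>(F * \<phi>) * \<delta> = (F * \<delta>) * \<phi>\<close>. After convolution with a mollifier \<open>\<psi>\<close> that turns
  \<open>u\<^sub>n * \<phi> - g\<close> into a null sequence, both sides are limits of \<open>u\<^sub>n * \<delta> * \<phi> * \<psi>\<close> at \<open>x\<close>, and \<open>\<psi>\<close> can be removed because both
  sides are continuous. The multiples of \<open>a\<close> are the room that the kernels need.\<close>

lemma conv_exchange:
  assumes "0 < a" "\<phi> \<in> molls a" "\<delta> \<in> molls a"
    and u: "\<And>n. continuous_on (cball x (4 * a)) (u n)" and g: "continuous_on (cball x (3 * a)) g"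
    and null: "\<And>y. y \<in> ball x (3 * a) \<Longrightarrow> germ (conv_null (\<lambda>n z. conv (u n) \<phi> z - g z)) y"
    and lim: "uniform_limit (cball x (2 * a)) (\<lambda>n. conv (u n) \<delta>) p sequentially"
  shows "conv g \<delta> x = conv p \<phi> x"
proof -
  note \<phi> = molls_D_o[OF assms(2)] molls_test_fun[OF assms(2)]
  note \<delta> = molls_D_o[OF assms(3)] molls_test_fun[OF assms(3)]
  have fits_c: "fits (cball x s) (cball x r) \<omega>" if "\<omega> \<in> molls b" "r + b \<le> s" for r s b \<omega>
    using that by (rule fits_cball)
  have fits_x: "fits (cball x s) {x} \<omega>" if "\<omega> \<in> molls b" "b \<le> s" for s b \<omega>
    using fits_subset[OF fits_cball[of \<omega> b 0 s x]] that by auto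
  have p: "continuous_on (cball x (2 * a)) p"
    by (rule continuous_limit_conv[OF u compact_cball \<delta>(1) fits_c[OF assms(3)] lim]) (use assms(1) in simp)
  have wc: "continuous_on (cball x (3 * a)) (\<lambda>z. conv (u n) \<phi> z - g z)" for n
    by (intro continuous_on_diff g continuous_conv_local[OF \<phi>(2) u] compact_cball fits_c[OF assms(2)]) simp
  then have wc': "continuous_on (ball x (3 * a)) (\<lambda>z. conv (u n) \<phi> z - g z)" for n
    by (rule continuous_on_subset) auto
  show ?thesis
  proof (rule eq_if_conv_eq[OF assms(1), where x = x and f = "conv g \<delta>" and g = "conv p \<phi>"])
    show "continuous_on (cball x a) (conv g \<delta>)"
      by (rule continuous_conv_local[OF \<delta>(2) g compact_cball fits_c[OF assms(3)]]) (use assms(1) in simp)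
    show "continuous_on (cball x a) (conv p \<phi>)"
      by (rule continuous_conv_local[OF \<phi>(2) p compact_cball fits_c[OF assms(2)]]) simp
    fix \<eta> :: real assume \<eta>: "0 < \<eta>"
    define e where "e = min \<eta> (a / 2)"
    have "0 < e" using \<eta> assms(1) by (simp add: e_def)
    have "\<exists>\<psi>\<in>molls e. conv_null (\<lambda>n z. conv (u n) \<phi> z - g z) (cball x (2 * a)) \<psi>"
      by (rule germs_imp_compact[OF open_ball local_property_null[OF wc'] null])
        (use assms(1) \<open>0 < e\<close> in auto)
    then obtain \<psi> where \<psi>: "\<psi> \<in> molls e" "conv_null (\<lambda>n z. conv (u n) \<phi> z - g z) (cball x (2 * a)) \<psi>"
      by blast
    note \<psi>' = molls_D_o[OF \<psi>(1)] molls_test_fun[OF \<psi>(1)]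
    have \<psi>a: "\<psi> \<in> molls (a / 2)" and "\<psi> \<in> molls \<eta>"
      using molls_mono[OF \<psi>(1)] by (simp_all add: e_def)
    define \<omega> where "\<omega> = conv \<delta> \<psi>"
    have \<omega>: "\<omega> \<in> molls (a + a / 2)"
      unfolding \<omega>_def by (rule molls_conv[OF assms(3) \<psi>a])
    have \<omega>_alt: "\<omega> = conv \<psi> \<delta>"
      unfolding \<omega>_def by (rule conv_commute[OF \<delta>(2) \<psi>'(2)])
    have "fits (ball x (3 * a)) (cball x (2 * a)) \<psi>"
      by (rule fits_subset[OF fits_c[OF \<psi>a, of "2 * a" "5 / 2 * a"]]) (use assms(1) in auto)
    from uniform_limit_conv[where u = "\<lambda>n z. conv (u n) \<phi> z - g z", OF wc' compact_cball \<psi>'(1) \<delta>(1) this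
        fits_x[OF assms(3)] \<psi>(2)[unfolded conv_null_def]] assms(1)
    have "uniform_limit {x} (\<lambda>n. conv (\<lambda>z. conv (u n) \<phi> z - g z) \<omega>) (\<lambda>_. 0) sequentially"
      by (simp add: \<omega>_alt conv_zero)
    then have lim0: "(\<lambda>n. conv (\<lambda>z. conv (u n) \<phi> z - g z) \<omega> x) \<longlonglongrightarrow> 0"
      by (rule tendsto_uniform_limitI) simp
    have fit\<omega>: "fits (cball x (3 * a)) {x} \<omega>"
      by (rule fits_x[OF \<omega>]) (use assms(1) in simp)
    then have sub\<omega>: "minus_supp x \<omega> \<subseteq> cball x (3 * a)" using fitsD by blast
    have conv_\<omega>: "conv (\<lambda>z. conv (u n) \<phi> z - g z) \<omega> x = conv (u n) (conv \<delta> (conv \<phi> \<psi>)) x - conv g \<omega> x" for n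
    proof -
      have fit\<phi>: "fits (cball x (4 * a)) (cball x (3 * a)) \<phi>"
        by (rule fits_c[OF assms(2)]) simp
      have "conv (\<lambda>z. conv (u n) \<phi> z - g z) \<omega> x = conv (conv (u n) \<phi>) \<omega> x - conv g \<omega> x"
        by (rule conv_diff[OF molls_test_fun[OF \<omega>]])
          (rule continuous_on_subset[OF continuous_conv_local[OF \<phi>(2) u compact_cball fit\<phi>] sub\<omega>]
             continuous_on_subset[OF g sub\<omega>])+
      also have "conv (conv (u n) \<phi>) \<omega> x = conv (u n) (conv \<phi> \<omega>) x"
        by (rule conv_assoc[OF \<phi>(2) molls_test_fun[OF \<omega>] u fit\<phi> fit\<omega>]) simp
      \<comment> \<open>Moving \<open>\<delta>\<close> to the front lets the convergence of \<open>u\<^sub>n * \<delta>\<close> take over.\<close>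
      also have "conv \<phi> \<omega> = conv \<delta> (conv \<phi> \<psi>)"
      proof
        fix z
        have "conv \<phi> \<omega> z = conv (conv \<phi> \<delta>) \<psi> z"
          unfolding \<omega>_def by (rule conv_assoc_global[symmetric, OF \<delta>(2) \<psi>'(2) test_fun_continuous[OF \<phi>(2)]])
        also have "conv \<phi> \<delta> = conv \<delta> \<phi>"
          by (rule conv_commute[OF \<phi>(2) \<delta>(2)])
        also have "conv (conv \<delta> \<phi>) \<psi> z = conv \<delta> (conv \<phi> \<psi>) z"
          by (rule conv_assoc_global[OF \<phi>(2) \<psi>'(2) test_fun_continuous[OF \<delta>(2)]])
        finally show "conv \<phi> \<omega> z = conv \<delta> (conv \<phi> \<psi>) z" .
      qed
      finally show ?thesis .
    qed
    have "(\<lambda>n. conv (u n) (conv \<delta> (conv \<phi> \<psi>)) x - conv g \<omega> x) \<longlonglongrightarrow> 0"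
      using lim0 unfolding conv_\<omega> .
    then have lim1: "(\<lambda>n. conv (u n) (conv \<delta> (conv \<phi> \<psi>)) x) \<longlonglongrightarrow> conv g \<omega> x"
      by (simp add: LIM_zero_iff)
    have \<phi>\<psi>: "conv \<phi> \<psi> \<in> molls (a + a / 2)"
      by (rule molls_conv[OF assms(2) \<psi>a])
    have fit\<delta>: "fits (cball x (4 * a)) (cball x (2 * a)) \<delta>"
      by (rule fits_c[OF assms(3)]) (use assms(1) in simp)
    have "uniform_limit {x} (\<lambda>n. conv (u n) (conv \<delta> (conv \<phi> \<psi>))) (conv p (conv \<phi> \<psi>)) sequentially"
      by (rule uniform_limit_conv[OF u compact_cball \<delta>(1) molls_D_o[OF \<phi>\<psi>] fit\<delta> fits_x[OF \<phi>\<psi>] lim])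
        (use assms(1) in simp)
    then have "(\<lambda>n. conv (u n) (conv \<delta> (conv \<phi> \<psi>)) x) \<longlonglongrightarrow> conv p (conv \<phi> \<psi>) x"
      by (rule tendsto_uniform_limitI) simp
    with lim1 have "conv g \<omega> x = conv p (conv \<phi> \<psi>) x"
      by (rule LIMSEQ_unique)
    moreover have "conv (conv g \<delta>) \<psi> x = conv g \<omega> x"
      unfolding \<omega>_def
      by (rule conv_assoc[OF \<delta>(2) \<psi>'(2) g fits_c[OF assms(3), of a] fits_x[OF \<psi>a, of a]]) (use assms(1) in simp_all)
    moreover have "conv (conv p \<phi>) \<psi> x = conv p (conv \<phi> \<psi>) x"
      by (rule conv_assoc[OF \<phi>(2) \<psi>'(2) p fits_c[OF assms(2), of a] fits_x[OF \<psi>a, of a]]) (use assms(1) in simp_all)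
    ultimately show "\<exists>\<psi>\<in>molls \<eta>. conv (conv g \<delta>) \<psi> x = conv (conv p \<phi>) \<psi> x"
      using \<open>\<psi> \<in> molls \<eta>\<close> by (intro bexI[of _ \<psi>]) simp_all
  qed
qed

text \<open>If \<open>g\<^sub>j = F * \<phi>\<^sub>j\<close> for the Boehmian \<open>F\<close> of \<open>u\<close>, with the ranges of \<open>\<phi>\<^sub>j\<close> tending to zero, then \<open>g\<close> represents \<open>F\<close> as well.
  For \<open>\<delta>\<close> such that \<open>u\<^sub>n * \<delta>\<close> converges to some \<open>p\<close>, the exchange law gives \<open>g\<^sub>j * \<delta> = p * \<phi>\<^sub>j\<close> for large \<open>j\<close>, and this converges
  to \<open>p\<close>. It is essential that \<open>\<delta>\<close> does not depend on \<open>j\<close>.\<close>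

lemma regularized_germ:
  assumes "open V" "x \<in> V" and u: "\<And>n. continuous_on V (u n)" and "germ (conv_convergent u) x"
    and g: "\<And>j. continuous_on UNIV (g j)" and \<phi>: "\<And>j. \<phi> j \<in> molls (\<rho> j)" and "\<rho> \<longlonglongrightarrow> 0"
    and null: "\<And>K. compact K \<Longrightarrow> K \<subseteq> V \<Longrightarrow>
      \<forall>\<^sub>F j in sequentially. \<forall>y\<in>K. germ (conv_null (\<lambda>n z. conv (u n) (\<phi> j) z - g j z)) y"
  shows "germ (conv_convergent g) x" "germ (conv_null (\<lambda>n z. u n z - g n z)) x"
proof -
  obtain R where R: "R > 0" "cball x R \<subseteq> V"
    using assms(1)[unfolded open_contains_cball, rule_format, OF assms(2)] by blast
  obtain r where r: "0 < r" "r \<le> R / 2" "\<forall>\<epsilon>>0. \<exists>\<delta>\<in>molls \<epsilon>. conv_convergent u (cball x r) \<delta>"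
    using germ_radius[OF assms(4) antitone_convergent, of "R / 2"] R(1) by auto
  \<comment> \<open>Convergence of \<open>u\<^sub>n * \<delta>\<close> on radius \<open>3a\<close> and \<open>cball x (5a) \<subseteq> V\<close> let \<open>conv_exchange\<close> apply at all points of
    \<open>cball x a\<close>.\<close>
  define a where "a = r / 3"
  have a: "0 < a" "r = 3 * a" "5 * a \<le> R"
    using r by (auto simp: a_def)
  have sub5: "cball x (5 * a) \<subseteq> V"
    using R(2) subset_cball[OF a(3), of x] by blast
  have main: "\<exists>\<delta>\<in>molls \<epsilon>. conv_convergent g (cball x a) \<delta> \<and> conv_null (\<lambda>n z. u n z - g n z) (cball x a) \<delta>"
    if \<epsilon>: "0 < \<epsilon>" for \<epsilon>
  proof -
    have "0 < min \<epsilon> a" using \<epsilon> a by simp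
    then obtain \<delta> where \<delta>: "\<delta> \<in> molls (min \<epsilon> a)" "conv_convergent u (cball x r) \<delta>"
      using r(3) by blast
    have \<delta>a: "\<delta> \<in> molls a" "\<delta> \<in> molls \<epsilon>"
      using molls_mono[OF \<delta>(1)] by simp_all
    obtain p where p: "uniform_limit (cball x (3 * a)) (\<lambda>n. conv (u n) \<delta>) p sequentially"
      using \<delta>(2) unfolding conv_convergent_def uniformly_convergent_on_def a(2) by blast
    have "fits (cball x (5 * a)) (cball x (3 * a)) \<delta>"
      by (rule fits_cball[OF \<delta>a(1)]) (use a in simp)
    then have fitV: "fits V (cball x (3 * a)) \<delta>"
      by (rule fits_subset[OF _ sub5 order_refl])
    have pc: "continuous_on (cball x (3 * a)) p"
      by (rule continuous_limit_conv[OF u compact_cball molls_D_o[OF \<delta>a(1)] fitV p])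
    have "uniform_limit (cball x a) (\<lambda>j. conv p (\<phi> j)) p sequentially"
      by (rule uniform_limit_conv_mollifiers[where a = "2 * a", OF _ _ \<phi> assms(7)]) (use a pc in simp_all)
    moreover have "\<forall>\<^sub>F j in sequentially. \<forall>y\<in>cball x a. conv p (\<phi> j) y = conv (g j) \<delta> y"
    proof -
      have "cball x (4 * a) \<subseteq> V"
        using sub5 subset_cball[of "4 * a" "5 * a" x] a by auto
      from null[OF compact_cball this]
      have "\<forall>\<^sub>F j in sequentially. \<forall>y\<in>cball x (4 * a). germ (conv_null (\<lambda>n z. conv (u n) (\<phi> j) z - g j z)) y" .
      moreover have "\<forall>\<^sub>F j in sequentially. \<rho> j < a"
        by (rule order_tendstoD(2)[OF assms(7) a(1)])
      ultimately show ?thesis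
      proof eventually_elim
        case (elim j)
        show ?case
        proof
          fix y assume y: "y \<in> cball x a"
          have "conv (g j) \<delta> y = conv p (\<phi> j) y"
          proof (rule conv_exchange[OF a(1) _ \<delta>a(1), where u = u])
            show "\<phi> j \<in> molls a" using molls_mono[OF \<phi>] elim(2) by (meson less_imp_le)
            have "cball y (4 * a) \<subseteq> cball x (5 * a)"
              by (rule cball_subset_cball) (use y in simp)
            then show "continuous_on (cball y (4 * a)) (u n)" for n
              using sub5 by (intro continuous_on_subset[OF u]) blast
            show "continuous_on (cball y (3 * a)) (g j)"
              by (rule continuous_on_subset[OF g]) simp
            have "cball y (2 * a) \<subseteq> cball x (3 * a)"
              by (rule cball_subset_cball) (use y in simp)
            then show "uniform_limit (cball y (2 * a)) (\<lambda>n. conv (u n) \<delta>) p sequentially"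
              using p uniform_limit_on_subset by blast
            fix z assume "z \<in> ball y (3 * a)"
            moreover have "cball y (3 * a) \<subseteq> cball x (4 * a)"
              by (rule cball_subset_cball) (use y in simp)
            ultimately have "z \<in> cball x (4 * a)"
              using ball_subset_cball[of y "3 * a"] by blast
            then show "germ (conv_null (\<lambda>n z. conv (u n) (\<phi> j) z - g j z)) z"
              using elim(1) by blast
          qed
          then show "conv p (\<phi> j) y = conv (g j) \<delta> y" by simp
        qed
      qed
    qed
    ultimately have gp: "uniform_limit (cball x a) (\<lambda>j. conv (g j) \<delta>) p sequentially"
      by (subst uniform_limit_cong[symmetric, where f = "\<lambda>j. conv p (\<phi> j)" and h = p]) auto
    have up: "uniform_limit (cball x a) (\<lambda>j. conv (u j) \<delta>) p sequentially"
      by (rule uniform_limit_on_subset[OF p]) (use a in auto)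
    have "uniform_limit (cball x a) (\<lambda>j y. conv (u j) \<delta> y - conv (g j) \<delta> y) (\<lambda>y. p y - p y) sequentially"
      by (rule uniform_limit_minus[OF up gp])
    moreover have "conv (\<lambda>z. u j z - g j z) \<delta> y = conv (u j) \<delta> y - conv (g j) \<delta> y" if y: "y \<in> cball x a" for j y
    proof -
      have "y \<in> cball x (3 * a)" using y a by simp
      from fitsD[OF fitV this] show ?thesis
        by (intro conv_diff molls_test_fun[OF \<delta>a(1)] continuous_on_subset[OF u] continuous_on_subset[OF g] subset_UNIV)
    qed
    ultimately have "conv_null (\<lambda>n z. u n z - g n z) (cball x a) \<delta>"
      by (intro conv_nullI) simp_all
    moreover have "conv_convergent g (cball x a) \<delta>"
      using gp unfolding conv_convergent_def uniformly_convergent_on_def by blast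
    ultimately show ?thesis using \<delta>a(2) by blast
  qed
  show "germ (conv_convergent g) x" "germ (conv_null (\<lambda>n z. u n z - g n z)) x"
    unfolding germ_def using main a(1) by blast+
qed

text \<open>The function \<open>g\<close> is \<open>F * \<phi>\<close> near \<open>K\<close> for the Boehmian \<open>F\<close> to be constructed. Finitely many balls cover \<open>K\<close>, each
  inside some \<open>U \<beta>\<close>, and a common mollifier \<open>\<phi>\<close> makes the sequences \<open>f \<beta> n\<close> of these balls converge. The limits agree where
  balls overlap, so they paste to a continuous function on the union of the closed balls, and the Tietze theorem extends
  it to the whole space. Each point of \<open>K\<close> is interior to one of the balls, whence the convergence to \<open>g\<close> itself near it.\<close>

lemma glued_regularization:
  fixes U :: "'i \<Rightarrow> 'a::euclidean_space set" and f :: "'i \<Rightarrow> nat \<Rightarrow> 'a \<Rightarrow> real"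
  assumes U: "\<And>\<alpha>. \<alpha> \<in> I \<Longrightarrow> open (U \<alpha>)"
    and f: "\<And>\<alpha> n. \<alpha> \<in> I \<Longrightarrow> continuous_on (U \<alpha>) (f \<alpha> n)"
    and convergent: "\<And>\<alpha> x. \<alpha> \<in> I \<Longrightarrow> x \<in> U \<alpha> \<Longrightarrow> germ (conv_convergent (f \<alpha>)) x"
    and compatible: "\<And>\<alpha> \<beta> x. \<alpha> \<in> I \<Longrightarrow> \<beta> \<in> I \<Longrightarrow> x \<in> U \<alpha> \<inter> U \<beta> \<Longrightarrow>
      germ (conv_null (\<lambda>n y. f \<alpha> n y - f \<beta> n y)) x"
    and "compact K" "K \<subseteq> (\<Union>\<alpha>\<in>I. U \<alpha>)" "0 < \<epsilon>"
  shows "\<exists>\<phi> \<rho> g. 0 < \<rho> \<and> \<rho> \<le> \<epsilon> \<and> \<phi> \<in> molls \<rho> \<and> continuous_on UNIV g \<and>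
    (\<forall>y\<in>K. \<exists>\<beta>\<in>I. \<exists>r>0. cball y (r + \<rho>) \<subseteq> U \<beta> \<and> uniform_limit (cball y r) (\<lambda>n. conv (f \<beta> n) \<phi>) g sequentially)"
proof -
  have "\<forall>x\<in>K. \<exists>\<beta> R. \<beta> \<in> I \<and> 0 < R \<and> cball x (3 * R) \<subseteq> U \<beta> \<and>
      (\<forall>\<epsilon>>0. \<exists>\<phi>\<in>molls \<epsilon>. conv_convergent (f \<beta>) (cball x (2 * R)) \<phi>)"
  proof
    fix x assume "x \<in> K"
    then obtain \<beta> where \<beta>: "\<beta> \<in> I" "x \<in> U \<beta>" using assms(6) by blast
    obtain R where R: "R > 0" "cball x R \<subseteq> U \<beta>"
      using U[OF \<beta>(1), unfolded open_contains_cball, rule_format, OF \<beta>(2)] by blast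
    obtain r where r: "0 < r" "r \<le> R / 2" "\<forall>\<epsilon>>0. \<exists>\<phi>\<in>molls \<epsilon>. conv_convergent (f \<beta>) (cball x r) \<phi>"
      using germ_radius[OF convergent[OF \<beta>] antitone_convergent, of "R / 2"] R(1) by auto
    have "cball x (3 * (r / 2)) \<subseteq> cball x R"
      by (rule subset_cball) (use r in simp)
    then have "cball x (3 * (r / 2)) \<subseteq> U \<beta>" using R(2) by blast
    with \<beta>(1) r show "\<exists>\<beta> R. \<beta> \<in> I \<and> 0 < R \<and> cball x (3 * R) \<subseteq> U \<beta> \<and>
      (\<forall>\<epsilon>>0. \<exists>\<phi>\<in>molls \<epsilon>. conv_convergent (f \<beta>) (cball x (2 * R)) \<phi>)"
      by (intro exI[of _ \<beta>] exI[of _ "r / 2"]) simp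
  qed
  from bchoice[OF this] obtain b where "\<forall>x\<in>K. \<exists>R. b x \<in> I \<and> 0 < R \<and> cball x (3 * R) \<subseteq> U (b x) \<and>
      (\<forall>\<epsilon>>0. \<exists>\<phi>\<in>molls \<epsilon>. conv_convergent (f (b x)) (cball x (2 * R)) \<phi>)" ..
  from bchoice[OF this] obtain R where R: "\<forall>x\<in>K. b x \<in> I \<and> 0 < R x \<and> cball x (3 * R x) \<subseteq> U (b x) \<and>
      (\<forall>\<epsilon>>0. \<exists>\<phi>\<in>molls \<epsilon>. conv_convergent (f (b x)) (cball x (2 * R x)) \<phi>)" ..
  have op: "open (ball x (R x))" for x by simp
  have cov: "K \<subseteq> (\<Union>x\<in>K. ball x (R x))"
  proof
    fix x assume x: "x \<in> K"
    then have "x \<in> ball x (R x)" using bspec[OF R x] by simp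
    with x show "x \<in> (\<Union>x\<in>K. ball x (R x))" by blast
  qed
  obtain A where A: "A \<subseteq> K" "finite A" "K \<subseteq> (\<Union>x\<in>A. ball x (R x))"
    using compactE_image[OF assms(5) op cov] by blast
  have b: "b x \<in> I" and R0: "0 < R x" and R3: "cball x (3 * R x) \<subseteq> U (b x)"
    and Rc: "\<forall>\<epsilon>>0. \<exists>\<phi>\<in>molls \<epsilon>. conv_convergent (f (b x)) (cball x (2 * R x)) \<phi>" if "x \<in> A" for x
    using bspec[OF R subsetD[OF A(1) that]] by simp_all
  have "\<forall>\<^sub>F \<rho> in at_right 0. \<forall>x\<in>A. \<rho> < R x / 2"
    using A(2) R0 by (intro eventually_ball_finite ballI order_tendstoD(2)[OF tendsto_ident_at]) auto
  moreover have "\<forall>\<^sub>F \<rho> in at_right 0. 0 < \<rho> \<and> \<rho> < \<epsilon>"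
    using assms(7) by (auto simp: eventually_at_right_field)
  ultimately have "\<forall>\<^sub>F \<rho> in at_right 0. (\<forall>x\<in>A. \<rho> < R x / 2) \<and> 0 < \<rho> \<and> \<rho> < \<epsilon>"
    by (rule eventually_conj)
  from eventually_happens'[OF _ this] obtain \<rho> where \<rho>: "\<forall>x\<in>A. \<rho> < R x / 2" "0 < \<rho>" "\<rho> < \<epsilon>"
    by (auto simp: trivial_limit_at_right_real)
  have "\<exists>\<phi>\<in>molls \<rho>. \<forall>x\<in>A. conv_convergent (f (b x)) (cball x (3 / 2 * R x)) \<phi>"
  proof (rule common_mollifier[where V = "\<lambda>x. U (b x)" and R = "\<lambda>x. 2 * R x" and x = "\<lambda>x. x"
        and Q = "\<lambda>x. conv_convergent (f (b x))"])
    fix x assume x: "x \<in> A"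
    show "local_property (U (b x)) (conv_convergent (f (b x)))"
      by (intro local_property_convergent f b x)
    show "open (U (b x))" by (intro U b x)
    have "cball x (2 * R x) \<subseteq> cball x (3 * R x)"
      by (rule subset_cball) (use R0[OF x] in simp)
    then show "cball x (2 * R x) \<subseteq> U (b x)" using R3[OF x] by blast
    show "3 / 2 * R x < 2 * R x" using R0[OF x] by simp
  qed (use A(2) Rc \<rho>(2) in auto)
  then obtain \<phi> where \<phi>: "\<phi> \<in> molls \<rho>" "\<forall>x\<in>A. conv_convergent (f (b x)) (cball x (3 / 2 * R x)) \<phi>"
    by blast
  then have "\<forall>x\<in>A. \<exists>h. uniform_limit (cball x (3 / 2 * R x)) (\<lambda>n. conv (f (b x) n) \<phi>) h sequentially"
    by (simp add: conv_convergent_def uniformly_convergent_on_def)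
  from bchoice[OF this] obtain h where
    h: "\<forall>x\<in>A. uniform_limit (cball x (3 / 2 * R x)) (\<lambda>n. conv (f (b x) n) \<phi>) (h x) sequentially" ..
  have lim: "uniform_limit (cball y r) (\<lambda>n. conv (f (b x) n) \<phi>) (h x) sequentially"
    and sub: "cball y (\<rho> + r) \<subseteq> U (b x)" "cball y r \<subseteq> cball x (3 / 2 * R x)"
    if "x \<in> A" "y \<in> cball x (R x)" "r \<le> R x / 2" for x y r
  proof -
    show s: "cball y r \<subseteq> cball x (3 / 2 * R x)"
      by (rule cball_subset_cball) (use that in simp)
    show "uniform_limit (cball y r) (\<lambda>n. conv (f (b x) n) \<phi>) (h x) sequentially"
      by (rule uniform_limit_on_subset[OF bspec[OF h that(1)] s])
    have "cball y (\<rho> + r) \<subseteq> cball x (3 * R x)"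
      by (rule cball_subset_cball) (use that bspec[OF \<rho>(1) that(1)] R0[OF that(1)] in simp)
    then show "cball y (\<rho> + r) \<subseteq> U (b x)" using R3[OF that(1)] by blast
  qed
  have fit: "fits (U (b x)) (cball x (3 / 2 * R x)) \<phi>" if x: "x \<in> A" for x
    by (rule fits_subset[OF fits_cball[OF \<phi>(1)] R3[OF x] order_refl])
      (use bspec[OF \<rho>(1) x] R0[OF x] in simp)
  have h_cont: "continuous_on (cball x (3 / 2 * R x)) (h x)" if x: "x \<in> A" for x
    by (rule continuous_limit_conv[OF f[OF b[OF x]] compact_cball molls_D_o[OF \<phi>(1)] fit[OF x] bspec[OF h x]])
  have h_eq: "h x y = h z y" if x: "x \<in> A" "y \<in> cball x (R x)" and z: "z \<in> A" "y \<in> cball z (R z)" for x y z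
  proof -
    \<comment> \<open>Near \<open>y\<close> the sequence of \<open>b x\<close> converges to \<open>h x\<close>, and by \<open>germ_null_transfer\<close> it approaches \<open>h z\<close> in the
      sense of germs.\<close>
    define r where "r = min (R x) (R z) / 2"
    have r: "0 < r" "r \<le> R x / 2" "r \<le> R z / 2"
      using R0[OF x(1)] R0[OF z(1)] by (auto simp: r_def)
    have fit': "fits (U (b x)) (cball y r) \<phi>"
      by (rule fits_subset[OF fit[OF x(1)] order_refl sub(2)[OF x r(2)]])
    show ?thesis
    proof (rule uniform_limit_eq_if_germ_null[OF r(1), where w = "\<lambda>n. conv (f (b x) n) \<phi>"])
      show "continuous_on (cball y r) (conv (f (b x) n) \<phi>)" for n
        by (rule continuous_conv_local[OF molls_test_fun[OF \<phi>(1)] f[OF b[OF x(1)]] compact_cball fit'])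
      show "continuous_on (cball y r) (h z)"
        by (rule continuous_on_subset[OF h_cont[OF z(1)] sub(2)[OF z r(3)]])
      show "uniform_limit (cball y r) (\<lambda>n. conv (f (b x) n) \<phi>) (h x) sequentially"
        by (rule lim[OF x r(2)])
      show "germ (conv_null (\<lambda>n w. conv (f (b x) n) \<phi> w - h z w)) y"
      proof (rule germ_null_transfer[OF r(1) _ _ \<phi>(1)])
        show "open (U (b x) \<inter> U (b z))"
          by (intro open_Int U b x z)
        show "cball y (\<rho> + r) \<subseteq> U (b x) \<inter> U (b z)"
          using sub(1)[OF x r(2)] sub(1)[OF z r(3)] by blast
        show "continuous_on (U (b x) \<inter> U (b z)) (f (b x) n)" for n
          by (rule continuous_on_subset[OF f[OF b[OF x(1)]]]) simp
        show "continuous_on (U (b x) \<inter> U (b z)) (f (b z) n)" for n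
          by (rule continuous_on_subset[OF f[OF b[OF z(1)]]]) simp
        show "germ (conv_null (\<lambda>n y. f (b x) n y - f (b z) n y)) w" if "w \<in> U (b x) \<inter> U (b z)" for w
          by (rule compatible[OF b[OF x(1)] b[OF z(1)] that])
        show "uniform_limit (cball y r) (\<lambda>n. conv (f (b z) n) \<phi>) (h z) sequentially"
          by (rule lim[OF z r(3)])
      qed
    qed
  qed
  \<comment> \<open>By \<open>h_eq\<close> the choice of the ball is immaterial.\<close>
  define g0 where "g0 = (\<lambda>y. h (SOME x. x \<in> A \<and> y \<in> cball x (R x)) y)"
  have g0: "g0 y = h x y" if x: "x \<in> A" "y \<in> cball x (R x)" for x y
  proof -
    have "\<exists>x. x \<in> A \<and> y \<in> cball x (R x)" using x by blast
    from someI_ex[OF this] show ?thesis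
      unfolding g0_def by (intro h_eq x) simp_all
  qed
  have "continuous_on (\<Union>x\<in>A. cball x (R x)) g0"
  proof (rule continuous_on_closed_Union[OF A(2)])
    fix x assume x: "x \<in> A"
    have "continuous_on (cball x (R x)) (h x)"
      by (rule continuous_on_subset[OF h_cont[OF x] subset_cball]) (use R0[OF x] in simp)
    then show "continuous_on (cball x (R x)) g0"
      by (rule continuous_on_eq) (simp add: g0[OF x])
  qed simp
  moreover have "compact (\<Union>x\<in>A. cball x (R x))"
    by (intro compact_UN A(2) compact_cball)
  ultimately obtain g where g: "continuous_on UNIV g" "\<And>y. y \<in> (\<Union>x\<in>A. cball x (R x)) \<Longrightarrow> g y = g0 y"
    using continuous_extension by blast
  have local_limit: "\<exists>\<beta>\<in>I. \<exists>r>0. cball y (r + \<rho>) \<subseteq> U \<beta> \<and> uniform_limit (cball y r) (\<lambda>n. conv (f \<beta> n) \<phi>) g sequentially"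
    if y: "y \<in> K" for y
  proof -
    obtain x where x: "x \<in> A" "y \<in> ball x (R x)"
      using y A(3) by blast
    define r where "r = min (R x / 2) (R x - dist x y)"
    have r: "0 < r"
      unfolding r_def using x(2) R0[OF x(1)] by simp
    have rR: "r \<le> R x / 2"
      unfolding r_def by (rule min.cobounded1)
    have yc: "y \<in> cball x (R x)" using x(2) by simp
    have "cball y r \<subseteq> cball x (R x)"
      by (rule cball_subset_cball) (simp add: r_def)
    have "g z = h x z" if "z \<in> cball y r" for z
    proof -
      have z: "z \<in> cball x (R x)"
        using \<open>cball y r \<subseteq> cball x (R x)\<close> that by blast
      then have "g z = g0 z" using x(1) by (intro g(2)) blast
      then show ?thesis using g0[OF x(1) z] by simp
    qed
    then have "uniform_limit (cball y r) (\<lambda>n. conv (f (b x) n) \<phi>) g sequentially"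
      using lim[OF x(1) yc rR] by (subst uniform_limit_cong[where g = "\<lambda>n. conv (f (b x) n) \<phi>" and i = "h x"]) auto
    moreover have "cball y (r + \<rho>) \<subseteq> U (b x)"
      using sub(1)[OF x(1) yc rR] by (simp add: add.commute)
    ultimately show ?thesis
      using b[OF x(1)] r by blast
  qed
  show ?thesis
    by (intro exI[of _ \<phi>] exI[of _ \<rho>] exI[of _ g] conjI ballI local_limit g(1) \<phi>(1) \<rho>(2) less_imp_le[OF \<rho>(3)])
qed

text \<open>The regularizations \<open>g\<^sub>j = F * \<phi>\<^sub>j\<close> along an exhaustion of the union by compact sets form a fundamental sequence that
  represents every \<open>f \<alpha>\<close> on \<open>U \<alpha>\<close>. The pieces that make up \<open>g\<^sub>j\<close> usually come from other indices than \<open>\<alpha>\<close>;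
  \<open>germ_null_transfer\<close> translates them to \<open>\<alpha>\<close>.\<close>

lemma glue_fundamental_seqs:
  fixes U :: "'i \<Rightarrow> 'a::euclidean_space set"
  assumes U: "\<And>\<alpha>. \<alpha> \<in> I \<Longrightarrow> open (U \<alpha>)"
    and f: "\<And>\<alpha>. \<alpha> \<in> I \<Longrightarrow> f \<alpha> \<in> fundamental_seqs (U \<alpha>)"
    and compatible: "\<And>\<alpha> \<beta> x. \<alpha> \<in> I \<Longrightarrow> \<beta> \<in> I \<Longrightarrow> x \<in> U \<alpha> \<inter> U \<beta> \<Longrightarrow>
      germ (conv_null (\<lambda>n y. f \<alpha> n y - f \<beta> n y)) x"
  obtains g where "g \<in> fundamental_seqs (\<Union>\<alpha>\<in>I. U \<alpha>)"
    "\<And>\<alpha> x. \<alpha> \<in> I \<Longrightarrow> x \<in> U \<alpha> \<Longrightarrow> germ (conv_null (\<lambda>n y. f \<alpha> n y - g n y)) x"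
proof -
  define W where "W = (\<Union>\<alpha>\<in>I. U \<alpha>)"
  have W: "open W" unfolding W_def by (intro open_UN ballI U)
  have fc: "continuous_on (U \<alpha>) (f \<alpha> n)" if "\<alpha> \<in> I" for \<alpha> n
    by (rule fundamental_continuous[OF f[OF that] order_refl])
  have fg: "germ (conv_convergent (f \<alpha>)) x" if "\<alpha> \<in> I" "x \<in> U \<alpha>" for \<alpha> x
    using f[OF that(1)] fundamental_iff[OF U[OF that(1)]] that(2) by blast
  obtain C :: "nat \<Rightarrow> 'a set" where C: "\<And>j. compact (C j)" "\<And>j. C j \<subseteq> W" "\<And>K. compact K \<Longrightarrow> K \<subseteq> W \<Longrightarrow> \<exists>N. \<forall>j\<ge>N. K \<subseteq> C j"
  proof (rule open_Union_compact_subsets[OF W])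
    fix C :: "nat \<Rightarrow> 'a set"
    assume C: "\<And>n. compact (C n)" "\<And>n. C n \<subseteq> W" "\<And>K. compact K \<Longrightarrow> K \<subseteq> W \<Longrightarrow> \<exists>N. \<forall>n\<ge>N. K \<subseteq> C n"
    show thesis by (rule that[of C]) (rule C; assumption)+
  qed
  let ?P = "\<lambda>j \<phi> \<rho> g. 0 < \<rho> \<and> \<rho> \<le> inverse (real (Suc j)) \<and> \<phi> \<in> molls \<rho> \<and> continuous_on UNIV g \<and>
    (\<forall>y\<in>C j. \<exists>\<beta>\<in>I. \<exists>r>0. cball y (r + \<rho>) \<subseteq> U \<beta> \<and> uniform_limit (cball y r) (\<lambda>n. conv (f \<beta> n) \<phi>) g sequentially)"
  have "\<exists>\<phi> \<rho> g. ?P j \<phi> \<rho> g" for j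
  proof (rule glued_regularization[where U = U and f = f and I = I])
    show "C j \<subseteq> (\<Union>\<alpha>\<in>I. U \<alpha>)" using C(2)[of j] unfolding W_def .
    show "0 < inverse (real (Suc j))" by simp
  qed (rule U fc fg compatible C(1); assumption)+
  then have "\<forall>j. \<exists>\<phi> \<rho> g. ?P j \<phi> \<rho> g" ..
  from choice[OF this] obtain \<phi> where "\<forall>j. \<exists>\<rho> g. ?P j (\<phi> j) \<rho> g" ..
  from choice[OF this] obtain \<rho> where "\<forall>j. \<exists>g. ?P j (\<phi> j) (\<rho> j) g" ..
  from choice[OF this] obtain g where P: "\<forall>j. ?P j (\<phi> j) (\<rho> j) (g j)" ..
  have \<rho>: "0 < \<rho> j" "\<rho> j \<le> inverse (real (Suc j))" and \<phi>: "\<phi> j \<in> molls (\<rho> j)" and g: "continuous_on UNIV (g j)"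
    and stage: "\<forall>y\<in>C j. \<exists>\<beta>\<in>I. \<exists>r>0. cball y (r + \<rho> j) \<subseteq> U \<beta> \<and>
      uniform_limit (cball y r) (\<lambda>n. conv (f \<beta> n) (\<phi> j)) (g j) sequentially" for j
    using spec[OF P, of j] by simp_all
  have \<rho>0: "\<rho> \<longlonglongrightarrow> 0"
    by (rule real_tendsto_sandwich[OF _ _ tendsto_const LIMSEQ_inverse_real_of_nat])
      (intro always_eventually allI less_imp_le[OF \<rho>(1)] \<rho>(2))+
  have germs: "germ (conv_convergent g) x \<and> germ (conv_null (\<lambda>n y. f \<alpha> n y - g n y)) x"
    if \<alpha>: "\<alpha> \<in> I" and x: "x \<in> U \<alpha>" for \<alpha> x
  proof -
    have null: "\<forall>\<^sub>F j in sequentially. \<forall>y\<in>K. germ (conv_null (\<lambda>n z. conv (f \<alpha> n) (\<phi> j) z - g j z)) y"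
      if K: "compact K" "K \<subseteq> U \<alpha>" for K
    proof -
      obtain e where e: "e > 0" "(\<Union>y\<in>K. cball y e) \<subseteq> U \<alpha>"
        by (rule compact_subset_open_imp_cball_epsilon_subset[OF K(1) U[OF \<alpha>] K(2)])
      have "K \<subseteq> W" using K(2) \<alpha> by (auto simp: W_def)
      then have "\<forall>\<^sub>F j in sequentially. K \<subseteq> C j"
        using C(3)[OF K(1)] by (simp add: eventually_sequentially)
      moreover have "\<forall>\<^sub>F j in sequentially. \<rho> j < e / 2"
        using \<rho>0 e(1) by (intro order_tendstoD) auto
      ultimately show ?thesis
      proof eventually_elim
        case (elim j)
        show ?case
        proof
          fix y assume y: "y \<in> K"
          then obtain \<beta> r where \<beta>: "\<beta> \<in> I" and r: "r > 0" "cball y (r + \<rho> j) \<subseteq> U \<beta>"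
              "uniform_limit (cball y r) (\<lambda>n. conv (f \<beta> n) (\<phi> j)) (g j) sequentially"
            using bspec[OF stage[of j] subsetD[OF elim(1) y]] by blast
          \<comment> \<open>The radius is cut down so that the ball, thickened by the range of \<open>\<phi> j\<close>, also lies in \<open>U \<alpha>\<close>.\<close>
          define s where "s = min r (e / 2)"
          have s: "0 < s" "s \<le> r" "s \<le> e / 2" using r(1) e(1) by (auto simp: s_def)
          show "germ (conv_null (\<lambda>n z. conv (f \<alpha> n) (\<phi> j) z - g j z)) y"
          proof (rule germ_null_transfer[OF s(1) _ _ \<phi>])
            show "open (U \<alpha> \<inter> U \<beta>)" by (intro open_Int U \<alpha> \<beta>)
            have "cball y (\<rho> j + s) \<subseteq> cball y e" "cball y (\<rho> j + s) \<subseteq> cball y (r + \<rho> j)"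
              by (rule subset_cball, use s elim(2) in simp)+
            then show "cball y (\<rho> j + s) \<subseteq> U \<alpha> \<inter> U \<beta>"
              using e(2) r(2) y by blast
            show "continuous_on (U \<alpha> \<inter> U \<beta>) (f \<alpha> n)" for n
              by (rule continuous_on_subset[OF fc[OF \<alpha>]]) simp
            show "continuous_on (U \<alpha> \<inter> U \<beta>) (f \<beta> n)" for n
              by (rule continuous_on_subset[OF fc[OF \<beta>]]) simp
            show "germ (conv_null (\<lambda>n z. f \<alpha> n z - f \<beta> n z)) z" if "z \<in> U \<alpha> \<inter> U \<beta>" for z
              by (rule compatible[OF \<alpha> \<beta> that])
            show "uniform_limit (cball y s) (\<lambda>n. conv (f \<beta> n) (\<phi> j)) (g j) sequentially"
              by (rule uniform_limit_on_subset[OF r(3) subset_cball[OF s(2)]])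
          qed
        qed
      qed
    qed
    show ?thesis
      by (intro conjI regularized_germ[OF U[OF \<alpha>] x fc[OF \<alpha>] fg[OF \<alpha> x] g \<phi> \<rho>0 null])
  qed
  show thesis
  proof
    let ?g = "restrict_seq g W"
    have eq: "?g n y = g n y" if "y \<in> W" for n y using that by simp
    have "?g n \<in> cont_funs W" for n
      using continuous_on_subset[OF g subset_UNIV, of W n] by (simp add: cont_funs_def cong: continuous_on_cong)
    moreover have "germ (conv_convergent ?g) x" if x: "x \<in> W" for x
    proof -
      obtain \<alpha> where "\<alpha> \<in> I" "x \<in> U \<alpha>" using x by (auto simp: W_def)
      then have "germ (conv_convergent g) x" using germs by blast
      then show ?thesis
        by (rule germ_convergent_cong[OF _ W x]) (simp add: eq)
    qed
    ultimately show "?g \<in> fundamental_seqs (\<Union>\<alpha>\<in>I. U \<alpha>)"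
      unfolding W_def[symmetric] by (subst fundamental_iff[OF W]) (intro conjI allI ballI)
    fix \<alpha> x assume \<alpha>: "\<alpha> \<in> I" "x \<in> U \<alpha>"
    then have "x \<in> W" by (auto simp: W_def)
    have "germ (conv_null (\<lambda>n y. f \<alpha> n y - g n y)) x"
      using germs[OF \<alpha>] by blast
    then show "germ (conv_null (\<lambda>n y. f \<alpha> n y - ?g n y)) x"
      by (rule germ_null_cong[OF _ W \<open>x \<in> W\<close>]) (simp add: eq)
  qed
qed

section \<open>The sheaf of Boehmians\<close>

lemma restrict_restrict_boehmian:
  assumes "open U" "open V" "open W" "W \<subseteq> V" "V \<subseteq> U" "F \<in> boehmians U"
  shows "boehmian_restrict W (boehmian_restrict V F) = boehmian_restrict W F"
proof -
  obtain f where f: "f \<in> fundamental_seqs U" "F = boehmian_class U f"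
    using assms(6) by (rule boehmiansE)
  have fV: "restrict_seq f V \<in> fundamental_seqs V"
    by (rule fundamental_restrict[OF assms(1,2,5) f(1)])
  have "restrict_seq (restrict_seq f V) W = restrict_seq f W"
    using assms(4) by (simp add: Int_absorb1)
  then show ?thesis
    using restrict_boehmian_class[OF assms(1,2,5) f(1)] restrict_boehmian_class[OF assms(2,3,4) fV]
      restrict_boehmian_class[OF assms(1,3) subset_trans[OF assms(4,5)] f(1)] f(2) by simp
qed

text \<open>Equality of Boehmians is a condition on germs, and every point of the union lies in some \<open>U \<alpha>\<close>.\<close>

lemma boehmian_eq_if_locally_eq:
  assumes U: "\<And>\<alpha>. \<alpha> \<in> I \<Longrightarrow> open (U \<alpha>)"
    and F: "F \<in> boehmians (\<Union>\<alpha>\<in>I. U \<alpha>)" and G: "G \<in> boehmians (\<Union>\<alpha>\<in>I. U \<alpha>)"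
    and eq: "\<And>\<alpha>. \<alpha> \<in> I \<Longrightarrow> boehmian_restrict (U \<alpha>) F = boehmian_restrict (U \<alpha>) G"
  shows "F = G"
proof -
  obtain f where f: "f \<in> fundamental_seqs (\<Union>\<alpha>\<in>I. U \<alpha>)" "F = boehmian_class (\<Union>\<alpha>\<in>I. U \<alpha>) f"
    using F by (rule boehmiansE)
  obtain g where g: "g \<in> fundamental_seqs (\<Union>\<alpha>\<in>I. U \<alpha>)" "G = boehmian_class (\<Union>\<alpha>\<in>I. U \<alpha>) g"
    using G by (rule boehmiansE)
  have W: "open (\<Union>\<alpha>\<in>I. U \<alpha>)" by (intro open_UN ballI U)
  have "germ (conv_null (\<lambda>n y. f n y - g n y)) x" if "\<alpha> \<in> I" "x \<in> U \<alpha>" for \<alpha> x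
  proof -
    have "U \<alpha> \<subseteq> (\<Union>\<alpha>\<in>I. U \<alpha>)" using that(1) by blast
    from restrict_class_eq_iff[OF W W U[OF that(1)] this this f(1) g(1)] eq[OF that(1)] that(2)
    show ?thesis by (simp add: f(2) g(2))
  qed
  then show ?thesis
    unfolding f(2) g(2) boehmian_class_eq_iff[OF W f(1) g(1)] by blast
qed

lemma glue_boehmians:
  assumes U: "\<And>\<alpha>. \<alpha> \<in> I \<Longrightarrow> open (U \<alpha>)"
    and F: "\<And>\<alpha>. \<alpha> \<in> I \<Longrightarrow> F \<alpha> \<in> boehmians (U \<alpha>)"
    and eq: "\<And>\<alpha> \<beta>. \<alpha> \<in> I \<Longrightarrow> \<beta> \<in> I \<Longrightarrow>
      boehmian_restrict (U \<alpha> \<inter> U \<beta>) (F \<alpha>) = boehmian_restrict (U \<alpha> \<inter> U \<beta>) (F \<beta>)"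
  shows "\<exists>G\<in>boehmians (\<Union>\<alpha>\<in>I. U \<alpha>). \<forall>\<alpha>\<in>I. boehmian_restrict (U \<alpha>) G = F \<alpha>"
proof -
  have "\<forall>\<alpha>\<in>I. \<exists>f. f \<in> fundamental_seqs (U \<alpha>) \<and> F \<alpha> = boehmian_class (U \<alpha>) f"
  proof
    fix \<alpha> assume "\<alpha> \<in> I"
    from F[OF this] show "\<exists>f. f \<in> fundamental_seqs (U \<alpha>) \<and> F \<alpha> = boehmian_class (U \<alpha>) f"
      by (rule boehmiansE) blast
  qed
  from bchoice[OF this] obtain f where
    f: "\<forall>\<alpha>\<in>I. f \<alpha> \<in> fundamental_seqs (U \<alpha>) \<and> F \<alpha> = boehmian_class (U \<alpha>) (f \<alpha>)" ..
  then have ff: "f \<alpha> \<in> fundamental_seqs (U \<alpha>)" and fF: "F \<alpha> = boehmian_class (U \<alpha>) (f \<alpha>)" if "\<alpha> \<in> I" for \<alpha>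
    using that by blast+
  have "germ (conv_null (\<lambda>n y. f \<alpha> n y - f \<beta> n y)) x" if "\<alpha> \<in> I" "\<beta> \<in> I" "x \<in> U \<alpha> \<inter> U \<beta>" for \<alpha> \<beta> x
    using restrict_class_eq_iff[OF U[OF that(1)] U[OF that(2)] open_Int[OF U[OF that(1)] U[OF that(2)]]
        Int_lower1 Int_lower2 ff[OF that(1)] ff[OF that(2)]] eq[OF that(1,2)] that(3)
    by (simp add: fF[OF that(1)] fF[OF that(2)])
  then obtain g where g: "g \<in> fundamental_seqs (\<Union>\<alpha>\<in>I. U \<alpha>)"
    "\<And>\<alpha> x. \<alpha> \<in> I \<Longrightarrow> x \<in> U \<alpha> \<Longrightarrow> germ (conv_null (\<lambda>n y. f \<alpha> n y - g n y)) x"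
    using glue_fundamental_seqs[of I U f, OF U ff] by blast
  have W: "open (\<Union>\<alpha>\<in>I. U \<alpha>)" by (intro open_UN ballI U)
  have "boehmian_restrict (U \<alpha>) (boehmian_class (\<Union>\<alpha>\<in>I. U \<alpha>) g) = F \<alpha>" if \<alpha>: "\<alpha> \<in> I" for \<alpha>
  proof -
    have "U \<alpha> \<subseteq> (\<Union>\<alpha>\<in>I. U \<alpha>)" using \<alpha> by blast
    from restrict_class_eq_iff[OF U[OF \<alpha>] W U[OF \<alpha>] order_refl this ff[OF \<alpha>] g(1)]
    have "boehmian_restrict (U \<alpha>) (F \<alpha>) = boehmian_restrict (U \<alpha>) (boehmian_class (\<Union>\<alpha>\<in>I. U \<alpha>) g)"
      using g(2)[OF \<alpha>] by (simp add: fF[OF \<alpha>])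
    moreover have "boehmian_restrict (U \<alpha>) (F \<alpha>) = F \<alpha>"
      using restrict_boehmian_class[OF U[OF \<alpha>] U[OF \<alpha>] order_refl ff[OF \<alpha>]] restrict_self[OF ff[OF \<alpha>]]
      by (simp add: fF[OF \<alpha>])
    ultimately show ?thesis by simp
  qed
  with boehmian_class_in[OF g(1)] show ?thesis by blast
qed

lemma restrict_in_boehmians:
  assumes "open U" "open V" "V \<subseteq> U" "F \<in> boehmians U"
  shows "boehmian_restrict V F \<in> boehmians V"
proof -
  obtain f where f: "f \<in> fundamental_seqs U" "F = boehmian_class U f"
    using assms(4) by (rule boehmiansE)
  show ?thesis
    unfolding f(2) restrict_boehmian_class[OF assms(1-3) f(1)]
    by (rule boehmian_class_in[OF fundamental_restrict[OF assms(1-3) f(1)]])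
qed

lemma restrict_boehmian_self:
  assumes "open V" "F \<in> boehmians V"
  shows "boehmian_restrict V F = F"
proof -
  obtain f where f: "f \<in> fundamental_seqs V" "F = boehmian_class V f"
    using assms(2) by (rule boehmiansE)
  show ?thesis
    unfolding f(2) restrict_boehmian_class[OF assms(1,1) order_refl f(1)] restrict_self[OF f(1)] ..
qed

theorem theorem5:
  shows "(\<forall>U V. \<forall>F \<in> boehmians U. open (U :: (real ^ 'n) set) \<and> open V \<and> V \<subseteq> U \<longrightarrow>
            boehmian_restrict V F \<in> boehmians V) \<and>
         (\<forall>V. \<forall>F \<in> boehmians V. open (V :: (real ^ 'n) set) \<longrightarrow> boehmian_restrict V F = F) \<and>
         (\<forall>U V W. \<forall>F \<in> boehmians U.
            open (U :: (real ^ 'n) set) \<and> open V \<and> open W \<and> W \<subseteq> V \<and> V \<subseteq> U \<longrightarrow>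
            boehmian_restrict W (boehmian_restrict V F) = boehmian_restrict W F) \<and>
         (\<forall>(I :: 'i set) (U :: 'i \<Rightarrow> (real ^ 'n) set). (\<forall>\<alpha>\<in>I. open (U \<alpha>)) \<longrightarrow>
            (\<forall>F \<in> boehmians (\<Union>\<alpha>\<in>I. U \<alpha>). \<forall>G \<in> boehmians (\<Union>\<alpha>\<in>I. U \<alpha>).
               (\<forall>\<alpha>\<in>I. boehmian_restrict (U \<alpha>) F = boehmian_restrict (U \<alpha>) G) \<longrightarrow> F = G) \<and>
            (\<forall>F. (\<forall>\<alpha>\<in>I. F \<alpha> \<in> boehmians (U \<alpha>)) \<and>
               (\<forall>\<alpha>\<in>I. \<forall>\<beta>\<in>I. boehmian_restrict (U \<alpha> \<inter> U \<beta>) (F \<alpha>)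
                            = boehmian_restrict (U \<alpha> \<inter> U \<beta>) (F \<beta>)) \<longrightarrow>
               (\<exists>G \<in> boehmians (\<Union>\<alpha>\<in>I. U \<alpha>). \<forall>\<alpha>\<in>I. boehmian_restrict (U \<alpha>) G = F \<alpha>)))"
proof (intro conjI allI ballI impI; (elim conjE)?)
  fix U V :: "(real ^ 'n) set" and F
  assume "F \<in> boehmians U" "open U" "open V" "V \<subseteq> U"
  then show "boehmian_restrict V F \<in> boehmians V"
    by (intro restrict_in_boehmians)
next
  fix V :: "(real ^ 'n) set" and F
  assume "F \<in> boehmians V" "open V"
  then show "boehmian_restrict V F = F"
    by (intro restrict_boehmian_self)
next
  fix U V W :: "(real ^ 'n) set" and F
  assume "F \<in> boehmians U" "open U" "open V" "open W" "W \<subseteq> V" "V \<subseteq> U"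
  then show "boehmian_restrict W (boehmian_restrict V F) = boehmian_restrict W F"
    by (intro restrict_restrict_boehmian)
next
  fix I :: "'i set" and U :: "'i \<Rightarrow> (real ^ 'n) set" and F G
  assume "\<forall>\<alpha>\<in>I. open (U \<alpha>)" "F \<in> boehmians (\<Union>\<alpha>\<in>I. U \<alpha>)" "G \<in> boehmians (\<Union>\<alpha>\<in>I. U \<alpha>)"
    "\<forall>\<alpha>\<in>I. boehmian_restrict (U \<alpha>) F = boehmian_restrict (U \<alpha>) G"
  then show "F = G"
    by (intro boehmian_eq_if_locally_eq[of I U F G]) simp_all
next
  fix I :: "'i set" and U :: "'i \<Rightarrow> (real ^ 'n) set" and F
  assume "\<forall>\<alpha>\<in>I. open (U \<alpha>)" "\<forall>\<alpha>\<in>I. F \<alpha> \<in> boehmians (U \<alpha>)"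
    "\<forall>\<alpha>\<in>I. \<forall>\<beta>\<in>I. boehmian_restrict (U \<alpha> \<inter> U \<beta>) (F \<alpha>) = boehmian_restrict (U \<alpha> \<inter> U \<beta>) (F \<beta>)"
  then show "\<exists>G\<in>boehmians (\<Union>\<alpha>\<in>I. U \<alpha>). \<forall>\<alpha>\<in>I. boehmian_restrict (U \<alpha>) G = F \<alpha>"
    by (intro glue_boehmians) blast+
qed

end
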